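(* Let $G$ be a topological group, let $H$ be a topological subgroup of $G$, let $\nu\in\mathrm{M}(H)$ be $H$-left-invariant, and let $\mu\in\mathrm{M}(G)$ with $\mu\nu=\mu$. Then, for every $f\in\mathrm{RUCB}(G)$, $$\mathbb{E}_{\hat\mu}\bigl(\overline{f}\,\big|\,\mathrm{S}(\pi_H)\bigr)=\overline{\Phi_\nu f}\qquad\hat\mu\text{-almost everywhere},$$ i.e., $\overline{\Phi_\nu f}$ is a version of the conditional expectation of $\overline f$, with respect to the probability measure $\hat\mu$ on $\mathrm{S}(G)$, relative to the $\sigma$-algebra $\{\mathrm{S}(\pi_H)^{-1}(B)\mid B\subseteq\mathrm{S}(G/H)\text{ Borel}\}$.
   Context: Uniform spaces. For a uniform space $X$, $\mathrm{UCB}(X)$ is the algebra of bounded uniformly continuous real-valued functions on $X$, $\mathrm{M}(X)$ the set of positive unital linear functionals on $\mathrm{UCB}(X)$, and $\mathrm{S}(X)\subseteq\mathrm{M}(X)$ the set of unital ring homomorphisms $\mathrm{UCB}(X)\to\mathbb{R}$, a compact Hausdorff space in the weak-$*$ topology. For $f\in\mathrm{UCB}(X)$ define the continuous function $\overline f\colon\mathrm{S}(X)\to\mathbb{R}$, $\overline f(\xi):=\xi(f)$. For $\mu\in\mathrm{M}(X)$, $\hat\mu$ is the unique regular Borel probability measure on $\mathrm{S}(X)$ with $\int\overline f\,d\hat\mu=\mu(f)$ for all $f\in\mathrm{UCB}(X)$. A uniformly continuous map $\phi\colon X\to Y$ induces a continuous map $\mathrm{S}(\phi)\colon\mathrm{S}(X)\to\mathrm{S}(Y)$,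 $\mathrm{S}(\phi)(\xi)(f):=\xi(f\circ\phi)$. Groups. A topological group $G$ carries its right uniformity, whose entourages are the sets containing $\{(x,y)\mid xy^{-1}\in U\}$ for some neighborhood $U$ of $e$; $\mathrm{RUCB}(G)$, $\mathrm{M}(G)$, $\mathrm{S}(G)$ denote $\mathrm{UCB}$, $\mathrm{M}$, $\mathrm{S}$ of this uniform space. $G/H=\{xH\mid x\in G\}$ carries the uniformity consisting of all $V\subseteq(G/H)^2$ for which there is a neighborhood $U$ of $e$ in $G$ such that $(xH,yH)\in V$ whenever $xy^{-1}\in U$; the map $\pi_H\colon G\to G/H$, $x\mapsto xH$, is uniformly continuous. Let $\lambda_g(x):=gx$. For $\nu\in\mathrm{M}(G)$, $f\in\mathrm{RUCB}(G)$, let $(\Phi_\nu f)(g):=\nu(f\circ\lambda_g)$, which gives $\Phi_\nu f\in\mathrm{RUCB}(G)$; the convolution product is $\mu\nu:=\mu\circ\Phi_\nu$. $\mathrm{M}(H)$ is regarded as a subset of $\mathrm{M}(G)$ by identifying $\nu\in\mathrm{M}(H)$ with $f\mapsto\nu(f|_H)$. $\nu\in\mathrm{M}(H)$ is $H$-left-invariant if $\nu(f\circ\lambda_h)=\nu(f)$ for all $f\in\mathrm{RUCB}(H)$, $h\in H$. Conditional expectation. For a probability space $(X,\mathscr{B},\mu)$, a sub-$\sigma$-algebra $\mathscr{B}_0\subseteq\mathscr{B}$ and integrable $f$, a $\mathscr{B}_0$-measurable integrable function $g$ is a version of the conditional expectation of $f$ relative to $\mathscr{B}_0$ if $\int\chi_Bf\,d\mu=\int\chi_Bg\,d\mu$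 for all $B\in\mathscr{B}_0$. *)

theory Defs
  imports "HOL-Probability.Probability" "HOL-Algebra.Coset"
begin

section \<open>Uniform spaces and the Samuel compactification\<close>

record 'a uspace =
  points :: "'a set"
  entourages :: "('a \<times> 'a) set set"

text \<open>
  Functions on a set are represented as elements of \<^const>\<open>extensional\<close> (constant
  \<^const>\<open>undefined\<close> outside the set), so that equality of HOL functions is equality
  of functions on that set. This applies to the functions in \<open>UCB X\<close> as well as to
  the functionals on \<open>UCB X\<close>.
\<close>

definition UCB :: "('a, 'z) uspace_scheme \<Rightarrow> ('a \<Rightarrow> real) set" where
  "UCB X = {f \<in> extensional (points X). bounded (f ` points X) \<and>
     (\<forall>e>0. \<exists>V\<in>entourages X. \<forall>(x, y)\<in>V. \<bar>f x - f y\<bar> < e)}"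

definition means :: "('a, 'z) uspace_scheme \<Rightarrow> (('a \<Rightarrow> real) \<Rightarrow> real) set" where
  "means X = {\<mu> \<in> extensional (UCB X).
     (\<forall>f\<in>UCB X. \<forall>g\<in>UCB X. \<mu> (\<lambda>x\<in>points X. f x + g x) = \<mu> f + \<mu> g) \<and>
     (\<forall>c. \<forall>f\<in>UCB X. \<mu> (\<lambda>x\<in>points X. c * f x) = c * \<mu> f) \<and>
     (\<forall>f\<in>UCB X. (\<forall>x\<in>points X. 0 \<le> f x) \<longrightarrow> 0 \<le> \<mu> f) \<and>
     \<mu> (\<lambda>x\<in>points X. 1) = 1}"

definition samuel :: "('a, 'z) uspace_scheme \<Rightarrow> (('a \<Rightarrow> real) \<Rightarrow> real) set" where
  "samuel X = {\<xi> \<in> extensional (UCB X).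
     (\<forall>f\<in>UCB X. \<forall>g\<in>UCB X. \<xi> (\<lambda>x\<in>points X. f x + g x) = \<xi> f + \<xi> g) \<and>
     (\<forall>f\<in>UCB X. \<forall>g\<in>UCB X. \<xi> (\<lambda>x\<in>points X. f x * g x) = \<xi> f * \<xi> g) \<and>
     \<xi> (\<lambda>x\<in>points X. 1) = 1}"

text \<open>The weak-* topology is the topology of pointwise convergence on \<open>UCB X\<close>.\<close>

definition samuel_top :: "('a, 'z) uspace_scheme \<Rightarrow> (('a \<Rightarrow> real) \<Rightarrow> real) topology" where
  "samuel_top X = subtopology (product_topology (\<lambda>_. euclideanreal) (UCB X)) (samuel X)"

definition bar :: "('a \<Rightarrow> real) \<Rightarrow> (('a \<Rightarrow> real) \<Rightarrow> real) \<Rightarrow> real" where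
  "bar f \<xi> = \<xi> f"

definition samuel_map ::
    "('a, 'z) uspace_scheme \<Rightarrow> ('b, 'w) uspace_scheme \<Rightarrow> ('a \<Rightarrow> 'b) \<Rightarrow>
     (('a \<Rightarrow> real) \<Rightarrow> real) \<Rightarrow> (('b \<Rightarrow> real) \<Rightarrow> real)" where
  "samuel_map X Y \<phi> = (\<lambda>\<xi>\<in>samuel X. \<lambda>f\<in>UCB Y. \<xi> (\<lambda>x\<in>points X. f (\<phi> x)))"

section \<open>Representing measures\<close>

definition borel_of_top :: "'a topology \<Rightarrow> 'a measure" where
  "borel_of_top T = sigma (topspace T) {U. openin T U}"

definition regular_borel_prob :: "'a topology \<Rightarrow> 'a measure \<Rightarrow> bool" where
  "regular_borel_prob T m \<longleftrightarrow>
     sets m = sets (borel_of_top T) \<and> prob_space m \<and>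
     (\<forall>A\<in>sets m. emeasure m A = (INF U\<in>{U. A \<subseteq> U \<and> openin T U}. emeasure m U)) \<and>
     (\<forall>A\<in>sets m. emeasure m A =
        (SUP K\<in>{K. K \<subseteq> A \<and> compactin T K \<and> K \<in> sets m}. emeasure m K))"

text \<open>
  The definite description denotes by the Riesz representation theorem, for
  \<open>\<mu> \<in> means X\<close>: \<open>samuel_top X\<close> is compact Hausdorff and the functions
  \<open>bar f\<close> are uniformly dense in its continuous functions.
\<close>

definition hat :: "('a, 'z) uspace_scheme \<Rightarrow> (('a \<Rightarrow> real) \<Rightarrow> real) \<Rightarrow> (('a \<Rightarrow> real) \<Rightarrow> real) measure" where
  "hat X \<mu> = (THE m. regular_borel_prob (samuel_top X) m \<and>
     (\<forall>f\<in>UCB X. integral\<^sup>L m (bar f) = \<mu> f))"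

section \<open>Topological groups\<close>

definition topological_group :: "('a, 'z) monoid_scheme \<Rightarrow> 'a topology \<Rightarrow> bool" where
  "topological_group G T \<longleftrightarrow> group G \<and> topspace T = carrier G \<and>
     continuous_map (prod_topology T T) T (\<lambda>(x, y). x \<otimes>\<^bsub>G\<^esub> y) \<and>
     continuous_map T T (\<lambda>x. inv\<^bsub>G\<^esub> x)"

definition nbhds_one :: "('a, 'z) monoid_scheme \<Rightarrow> 'a topology \<Rightarrow> 'a set set" where
  "nbhds_one G T = {U. U \<subseteq> carrier G \<and> (\<exists>W. openin T W \<and> \<one>\<^bsub>G\<^esub> \<in> W \<and> W \<subseteq> U)}"

definition right_uspace :: "('a, 'z) monoid_scheme \<Rightarrow> 'a topology \<Rightarrow> 'a uspace" where
  "right_uspace G T = \<lparr>points = carrier G,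
     entourages = {V. V \<subseteq> carrier G \<times> carrier G \<and>
       (\<exists>U\<in>nbhds_one G T.
          {(x, y). x \<in> carrier G \<and> y \<in> carrier G \<and> x \<otimes>\<^bsub>G\<^esub> inv\<^bsub>G\<^esub> y \<in> U} \<subseteq> V)}\<rparr>"

definition coset_proj :: "('a, 'z) monoid_scheme \<Rightarrow> 'a set \<Rightarrow> 'a \<Rightarrow> 'a set" where
  "coset_proj G H x = x <#\<^bsub>G\<^esub> H"

definition coset_uspace ::
    "('a, 'z) monoid_scheme \<Rightarrow> 'a topology \<Rightarrow> 'a set \<Rightarrow> 'a set uspace" where
  "coset_uspace G T H = \<lparr>points = coset_proj G H ` carrier G,
     entourages = {V. V \<subseteq> (coset_proj G H ` carrier G) \<times> (coset_proj G H ` carrier G) \<and>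
       (\<exists>U\<in>nbhds_one G T. \<forall>x\<in>carrier G. \<forall>y\<in>carrier G.
          x \<otimes>\<^bsub>G\<^esub> inv\<^bsub>G\<^esub> y \<in> U \<longrightarrow> (coset_proj G H x, coset_proj G H y) \<in> V)}\<rparr>"

abbreviation RUCB :: "('a, 'z) monoid_scheme \<Rightarrow> 'a topology \<Rightarrow> ('a \<Rightarrow> real) set" where
  "RUCB G T \<equiv> UCB (right_uspace G T)"

definition Phi ::
    "('a, 'z) monoid_scheme \<Rightarrow> (('a \<Rightarrow> real) \<Rightarrow> real) \<Rightarrow> ('a \<Rightarrow> real) \<Rightarrow> 'a \<Rightarrow> real" where
  "Phi G \<nu> f = (\<lambda>g\<in>carrier G. \<nu> (\<lambda>x\<in>carrier G. f (g \<otimes>\<^bsub>G\<^esub> x)))"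

definition mean_conv ::
    "('a, 'z) monoid_scheme \<Rightarrow> 'a topology \<Rightarrow> (('a \<Rightarrow> real) \<Rightarrow> real) \<Rightarrow>
     (('a \<Rightarrow> real) \<Rightarrow> real) \<Rightarrow> ('a \<Rightarrow> real) \<Rightarrow> real" where
  "mean_conv G T \<mu> \<nu> = (\<lambda>f\<in>RUCB G T. \<mu> (Phi G \<nu> f))"

text \<open>The inclusion of the means on a subgroup \<open>H\<close> into the means on \<open>G\<close>.\<close>

definition embed_mean ::
    "('a, 'z) monoid_scheme \<Rightarrow> 'a topology \<Rightarrow> 'a set \<Rightarrow> (('a \<Rightarrow> real) \<Rightarrow> real) \<Rightarrow>
     ('a \<Rightarrow> real) \<Rightarrow> real" where
  "embed_mean G T H \<nu> = (\<lambda>f\<in>RUCB G T. \<nu> (restrict f H))"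

definition left_invariant ::
    "('a, 'z) monoid_scheme \<Rightarrow> 'a topology \<Rightarrow> (('a \<Rightarrow> real) \<Rightarrow> real) \<Rightarrow> bool" where
  "left_invariant G T \<nu> \<longleftrightarrow>
     (\<forall>f\<in>RUCB G T. \<forall>h\<in>carrier G. \<nu> (\<lambda>x\<in>carrier G. f (h \<otimes>\<^bsub>G\<^esub> x)) = \<nu> f)"

section \<open>Conditional expectation\<close>

text \<open>
  The first three conjuncts record the standing assumptions under which the notion
  is defined; they matter because \<^const>\<open>lebesgue_integral\<close> is 0 on non-integrable
  functions.
\<close>

definition cond_exp_version ::
    "'a measure \<Rightarrow> 'a measure \<Rightarrow> ('a \<Rightarrow> real) \<Rightarrow> ('a \<Rightarrow> real) \<Rightarrow> bool" where
  "cond_exp_version M F f g \<longleftrightarrow>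
     prob_space M \<and> subalgebra M F \<and> integrable M f \<and>
     g \<in> borel_measurable F \<and> integrable M g \<and>
     (\<forall>B\<in>sets F. (\<integral>x. indicator B x * f x \<partial>M) = (\<integral>x. indicator B x * g x \<partial>M))"

end

theory Submission
  imports Defs
begin

text \<open>
  Right \<open>H\<close>-invariant functions on \<open>G\<close> are exactly the pullbacks \<open>k \<circ> \<pi>\<close> along
  \<open>\<pi> : G \<rightarrow> G / H\<close>. Left invariance of \<open>\<nu>\<close> makes \<open>\<Phi>\<^sub>\<nu> f\<close> right \<open>H\<close>-invariant, so
  its extension to \<open>S(G)\<close> factors through \<open>S(\<pi>)\<close>; and since \<open>\<Phi>\<^sub>\<nu> ((k \<circ> \<pi>) f) = (k \<circ> \<pi>) \<Phi>\<^sub>\<nu> f\<close>,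
  the identity \<open>\<mu> = \<mu> \<circ> \<Phi>\<^sub>\<nu>\<close> says that \<open>f\<close> and \<open>\<Phi>\<^sub>\<nu> f\<close> have the same integral against
  every \<open>k \<circ> \<pi>\<close>. Regularity of the representing measure passes from these functions to
  indicators of Borel sets. The representing measure itself comes from a Riesz theorem for
  a vector lattice of continuous functions that separates the points of a compact space; working
  with a lattice avoids showing that the functions \<open>bar f\<close> exhaust all continuous functions.
\<close>

section \<open>Riesz representation on a compact space\<close>

text \<open>\<open>hat\<close> is a definite description, so nothing can be said about it before
  existence and uniqueness of the representing measure are both established; this is what makes a
  Riesz theorem unavoidable. The lattice is available because a unital ring homomorphism on
  \<open>UCB X\<close> commutes with absolute values: nonnegative functions are squares, and |f| has
  the same square as f. Since the abstract class \<open>A\<close> is closed under minima but not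
  assumed closed under products, minima take over the usual role of partitions of unity. The
  Hausdorff property is carried by \<open>separates\<close>. The delicate passage is from functions
  on S(G/H) to Borel subsets of S(G/H). The approximation is made on S(G), where the representing
  measure is known to be regular: compact sets, rather than the measure, are pushed forward along
  S(\<pi>).\<close>

locale separating_lattice =
  fixes T :: "'b topology" and A :: "('b \<Rightarrow> real) set"
  assumes compact: "compact_space T"
    and cont: "f \<in> A \<Longrightarrow> continuous_map T euclideanreal f"
    and add_closed: "f \<in> A \<Longrightarrow> g \<in> A \<Longrightarrow> (\<lambda>x. f x + g x) \<in> A"
    and scale_closed: "f \<in> A \<Longrightarrow> (\<lambda>x. c * f x) \<in> A"
    and abs_closed: "f \<in> A \<Longrightarrow> (\<lambda>x. \<bar>f x\<bar>) \<in> A"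
    and one_closed: "(\<lambda>x. 1) \<in> A"
    and separates: "x \<in> topspace T \<Longrightarrow> y \<in> topspace T \<Longrightarrow> x \<noteq> y \<Longrightarrow> \<exists>f\<in>A. f x \<noteq> f y"
begin

lemma const_closed: "(\<lambda>x. c) \<in> A"
  using scale_closed[OF one_closed, of c] by simp

lemma minus_closed: "f \<in> A \<Longrightarrow> (\<lambda>x. - f x) \<in> A"
  using scale_closed[of f "-1"] by simp

lemma diff_closed: "f \<in> A \<Longrightarrow> g \<in> A \<Longrightarrow> (\<lambda>x. f x - g x) \<in> A"
  using add_closed[OF _ minus_closed, of f g] by simp

lemma max_closed:
  assumes "f \<in> A" "g \<in> A"
  shows "(\<lambda>x. max (f x) (g x)) \<in> A"
proof -
  have "(\<lambda>x. max (f x) (g x)) = (\<lambda>x. (1 / 2) * ((f x + g x) + \<bar>f x - g x\<bar>))"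
    by (auto simp: max_def)
  then show ?thesis
    using assms by (simp only: scale_closed add_closed abs_closed diff_closed)
qed

lemma min_closed: "f \<in> A \<Longrightarrow> g \<in> A \<Longrightarrow> (\<lambda>x. min (f x) (g x)) \<in> A"
  using minus_closed[OF max_closed[OF minus_closed minus_closed], of f g]
  by (simp add: minus_max_eq_min)

lemmas lattice_closed = const_closed add_closed scale_closed diff_closed max_closed min_closed

lemma openin_less: "f \<in> A \<Longrightarrow> openin T {x \<in> topspace T. f x < a}"
  using openin_continuous_map_preimage[OF cont, of f "{..<a}"] by simp

lemma openin_greater: "f \<in> A \<Longrightarrow> openin T {x \<in> topspace T. f x > a}"
  using openin_continuous_map_preimage[OF cont, of f "{a<..}"] by simp

lemma closedin_ge: "f \<in> A \<Longrightarrow> closedin T {x \<in> topspace T. f x \<ge> a}"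
  using closedin_continuous_map_preimage[OF cont, of f "{a..}"] by simp

text \<open>A finite subcover followed by a finite minimum. \<open>P\<close> records a property that
  survives minima, so it passes from the pointwise witnesses to the single function;
  \<open>ne\<close> supplies the function for the empty subcover. \<open>urysohn\<close> uses this
  twice, once for each of the two sets.\<close>

lemma compact_below:
  assumes "compactin T L"
    and ex: "\<And>y. y \<in> L \<Longrightarrow> \<exists>f\<in>A. P f \<and> f y < a"
    and min: "\<And>f g. P f \<Longrightarrow> P g \<Longrightarrow> P (\<lambda>x. min (f x) (g x))"
    and ne: "\<exists>f\<in>A. P f"
  shows "\<exists>f\<in>A. P f \<and> (\<forall>y\<in>L. f y < a)"
proof -
  let ?U = "\<lambda>f. {z \<in> topspace T. f z < a}"
  have "L \<subseteq> \<Union> (?U ` {f \<in> A. P f})"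
    using ex compactin_subset_topspace[OF assms(1)] by fastforce
  then have "\<exists>\<F>. finite \<F> \<and> \<F> \<subseteq> ?U ` {f \<in> A. P f} \<and> L \<subseteq> \<Union>\<F>"
    by (rule compactinD[OF assms(1), rotated]) (use openin_less in auto)
  then obtain \<F> where \<F>: "finite \<F>" "\<F> \<subseteq> ?U ` {f \<in> A. P f}" "L \<subseteq> \<Union>\<F>"
    by (elim exE conjE)
  then obtain F where "finite F" "F \<subseteq> {f \<in> A. P f}" "\<F> = ?U ` F"
    using finite_subset_image[OF \<F>(1,2)] by (elim exE conjE)
  with \<F>(3) have F: "finite F" "F \<subseteq> {f \<in> A. P f}" "L \<subseteq> (\<Union>f\<in>F. ?U f)"
    by simp_all
  have "\<exists>g\<in>A. P g \<and> (\<forall>f\<in>F. \<forall>z. g z \<le> f z)"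
    using F(1,2)
  proof (induction F)
    case empty
    then show ?case using ne by auto
  next
    case (insert h F)
    then obtain g where "g \<in> A" "P g" "\<forall>f\<in>F. \<forall>z. g z \<le> f z" by auto
    then show ?case
      using insert.prems min[of h g] min_closed[of h g]
      by (intro bexI[of _ "\<lambda>x. min (h x) (g x)"]) (auto simp: min_le_iff_disj)
  qed
  then obtain g where g: "g \<in> A" "P g" "\<And>f z. f \<in> F \<Longrightarrow> g z \<le> f z" by auto
  have "g y < a" if "y \<in> L" for y
    using F(3) that by (auto intro: le_less_trans[OF g(3)])
  with g show ?thesis by blast
qed

text \<open>Points are separated by assumption; one use of compactness separates a point of
  \<open>K\<close> from \<open>L\<close>, a second one separates \<open>K\<close> from
  \<open>L\<close>. The strict margins make the final clipping to [0, 1] exact on both sets.\<close>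

lemma urysohn:
  assumes K: "compactin T K" and L: "compactin T L" and "K \<inter> L = {}"
  obtains f where "f \<in> A" "\<And>x. 0 \<le> f x" "\<And>x. f x \<le> 1"
    "\<And>x. x \<in> K \<Longrightarrow> f x = 1" "\<And>x. x \<in> L \<Longrightarrow> f x = 0"
proof -
  have sub: "K \<subseteq> topspace T" "L \<subseteq> topspace T"
    using K L compactin_subset_topspace by auto
  have 1: "\<exists>f\<in>A. f x > 1 \<and> (\<forall>y\<in>L. f y < 0)" if x: "x \<in> K" for x
  proof (rule compact_below[OF L])
    fix y assume y: "y \<in> L"
    then obtain h where h: "h \<in> A" "h x \<noteq> h y"
      using separates[of x y] sub assms(3) x by blast
    show "\<exists>f\<in>A. 1 < f x \<and> f y < 0"
    proof -
      \<comment> \<open>The factor is chosen so that c (h z - h y) - 1 takes the value 2 at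
        \<open>x\<close> and -1 at \<open>y\<close>.\<close>
      define c where "c = 3 / (h x - h y)"
      have "c * (h x - h y) = 3" unfolding c_def using h(2)
        by (simp only: times_divide_eq_left right_minus_eq nonzero_mult_div_cancel_right not_False_eq_True)
      then show ?thesis
        using h(1) by (intro bexI[of _ "\<lambda>z. c * (h z - h y) - 1"] lattice_closed) auto
    qed
  next
    show "\<exists>f\<in>A. 1 < f x" using const_closed[of 2] by (intro bexI[of _ "\<lambda>x. 2"]) auto
  qed auto
  have "\<exists>f\<in>A. (\<forall>y\<in>L. 0 < f y) \<and> (\<forall>x\<in>K. f x < -1)"
  proof (rule compact_below[OF K])
    fix x assume "x \<in> K"
    from 1[OF this] obtain f where "f \<in> A" "f x > 1" "\<forall>y\<in>L. f y < 0" by auto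
    then show "\<exists>f\<in>A. (\<forall>y\<in>L. 0 < f y) \<and> f x < -1"
      by (intro bexI[of _ "\<lambda>x. - f x"] minus_closed) auto
  next
    show "\<exists>f\<in>A. (\<forall>y\<in>L. 0 < f y)" using one_closed by (intro bexI[of _ "\<lambda>x. 1"]) auto
  qed auto
  then obtain f where f: "f \<in> A" "\<And>y. y \<in> L \<Longrightarrow> 0 < f y" "\<And>x. x \<in> K \<Longrightarrow> f x < -1" by auto
  show ?thesis
  \<comment> \<open>On \<open>K\<close> the function -f exceeds 1 and on \<open>L\<close> it is
    negative, so clipping gives the values 1 and 0.\<close>
  proof (rule that[of "\<lambda>x. max 0 (min 1 (- f x))"])
    show "(\<lambda>x. max 0 (min 1 (- f x))) \<in> A"
      using f(1) by (intro lattice_closed minus_closed)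
  qed (use f in \<open>fastforce simp: max_def min_def\<close>)+
qed

lemma urysohn_open:
  assumes "compactin T K" "openin T U" "K \<subseteq> U"
  obtains f where "f \<in> A" "\<And>x. 0 \<le> f x" "\<And>x. f x \<le> 1"
    "\<And>x. x \<in> K \<Longrightarrow> f x = 1" "\<And>x. x \<in> topspace T - U \<Longrightarrow> f x = 0"
proof -
  have "compactin T (topspace T - U)"
    by (intro closedin_compact_space compact) (use assms in auto)
  moreover have "K \<inter> (topspace T - U) = {}"
    using assms(3) by blast
  ultimately show ?thesis
    using urysohn[OF assms(1)] that by metis
qed

lemma bounded_closed:
  assumes "f \<in> A"
  obtains B where "0 < B" "\<And>x. x \<in> topspace T \<Longrightarrow> \<bar>f x\<bar> \<le> B"
proof -
  have "compactin euclideanreal (f ` topspace T)"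
    using image_compactin[OF _ cont[OF assms]] compact by (simp add: compact_space_def)
  then have "bounded (f ` topspace T)"
    by (simp add: compact_imp_bounded)
  then show ?thesis
    unfolding bounded_pos using that by auto
qed

end

section \<open>Borel sets of an explicit topology and regular probability measures\<close>

lemma space_borel_of_top: "space (borel_of_top T) = topspace T"
  by (simp add: borel_of_top_def space_measure_of_conv)

lemma sets_borel_of_top: "sets (borel_of_top T) = sigma_sets (topspace T) {U. openin T U}"
  unfolding borel_of_top_def by (rule sets_measure_of) (auto dest: openin_subset)

lemma openin_borel_of_top: "openin T U \<Longrightarrow> U \<in> sets (borel_of_top T)"
  by (auto simp: sets_borel_of_top)

lemma closedin_borel_of_top: "closedin T C \<Longrightarrow> C \<in> sets (borel_of_top T)"
  using sets.compl_sets[of "topspace T - C" "borel_of_top T"] openin_borel_of_top[of T "topspace T - C"]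
  by (simp add: space_borel_of_top closedin_def double_diff)

lemma continuous_map_measurable_borel_of_top:
  assumes "continuous_map T S f"
  shows "f \<in> measurable (borel_of_top T) (borel_of_top S)"
  unfolding borel_of_top_def[of S]
proof (rule measurable_measure_of)
  fix U assume "U \<in> {U. openin S U}"
  then show "f -` U \<inter> space (borel_of_top T) \<in> sets (borel_of_top T)"
    using openin_continuous_map_preimage[OF assms, of U]
    by (auto simp: space_borel_of_top vimage_def Int_def conj_commute intro: openin_borel_of_top)
qed (use assms in \<open>auto simp: space_borel_of_top continuous_map_def dest: openin_subset\<close>)

lemma borel_of_top_euclidean: "borel_of_top euclidean = borel"
  by (simp add: borel_of_top_def borel_def)

lemma continuous_map_borel_measurable:
  "continuous_map T euclidean f \<Longrightarrow> f \<in> borel_measurable (borel_of_top T)"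
  using continuous_map_measurable_borel_of_top[of T euclidean f] by (simp add: borel_of_top_euclidean)

lemma regular_borel_probD:
  assumes "regular_borel_prob T m"
  shows "sets m = sets (borel_of_top T)" "prob_space m" "space m = topspace T"
    and "A \<in> sets m \<Longrightarrow> emeasure m A = (INF U\<in>{U. A \<subseteq> U \<and> openin T U}. emeasure m U)"
    and "A \<in> sets m \<Longrightarrow>
      emeasure m A = (SUP K\<in>{K. K \<subseteq> A \<and> compactin T K \<and> K \<in> sets m}. emeasure m K)"
  using assms sets_eq_imp_space_eq[of m "borel_of_top T"]
  unfolding regular_borel_prob_def space_borel_of_top by blast+

lemma (in separating_lattice) integrable_lattice:
  assumes m: "regular_borel_prob T m" and f: "f \<in> A"
  shows "integrable m f"
proof -
  interpret prob_space m using regular_borel_probD(2)[OF m] .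
  obtain B where "\<And>x. x \<in> topspace T \<Longrightarrow> \<bar>f x\<bar> \<le> B" using bounded_closed[OF f] by blast
  moreover have "f \<in> borel_measurable m"
    using continuous_map_borel_measurable[OF cont[OF f]] measurable_cong_sets[OF regular_borel_probD(1)[OF m]]
    by blast
  ultimately show ?thesis
    by (intro integrable_const_bound[of _ B]) (auto simp: regular_borel_probD(3)[OF m])
qed

section \<open>The outer measure induced by a positive normalized functional\<close>

locale lattice_mean = separating_lattice T A for T :: "'b topology" and A +
  fixes I :: "('b \<Rightarrow> real) \<Rightarrow> real"
  assumes I_add: "f \<in> A \<Longrightarrow> g \<in> A \<Longrightarrow> I (\<lambda>x. f x + g x) = I f + I g"
    and I_scale: "f \<in> A \<Longrightarrow> I (\<lambda>x. c * f x) = c * I f"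
    and I_nonneg: "f \<in> A \<Longrightarrow> (\<And>x. x \<in> topspace T \<Longrightarrow> 0 \<le> f x) \<Longrightarrow> 0 \<le> I f"
    and I_one: "I (\<lambda>x. 1) = 1"
begin

lemma I_diff: "f \<in> A \<Longrightarrow> g \<in> A \<Longrightarrow> I (\<lambda>x. f x - g x) = I f - I g"
  using I_add[OF _ minus_closed, of f g] I_scale[of g "-1"] by simp

lemma I_const: "I (\<lambda>x. c) = c"
  using I_scale[OF one_closed, of c] I_one by simp

lemma I_mono:
  assumes "f \<in> A" "g \<in> A" "\<And>x. x \<in> topspace T \<Longrightarrow> f x \<le> g x"
  shows "I f \<le> I g"
  using I_nonneg[OF diff_closed[OF assms(2,1)]] I_diff[OF assms(2,1)] assms(3) by simp

text \<open>Both claims are proved in one induction because \<open>I_add\<close> requires membership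
  of the partial sum in \<open>A\<close>.\<close>

lemma sum_closed:
  fixes n :: nat
  shows
  "(\<And>k. k < n \<Longrightarrow> f k \<in> A) \<Longrightarrow> (\<lambda>x. \<Sum>k<n. f k x) \<in> A \<and> I (\<lambda>x. \<Sum>k<n. f k x) = (\<Sum>k<n. I (f k))"
  by (induction n) (auto simp: const_closed I_const add_closed I_add)

text \<open>Vanishing off \<open>U\<close> stands in for having compact support inside
  \<open>U\<close>; \<open>cutoff\<close> restores compactness at a small cost. \<open>U\<close>
  ranges over arbitrary sets since \<open>cutoff_le\<close> also uses the closed superlevel sets of
  a function.\<close>

definition subordinate :: "'b set \<Rightarrow> ('b \<Rightarrow> real) set" where
  "subordinate U = {f \<in> A. \<forall>x\<in>topspace T. 0 \<le> f x \<and> f x \<le> 1 \<and> (x \<notin> U \<longrightarrow> f x = 0)}"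

definition mass :: "'b set \<Rightarrow> ennreal" where
  "mass U = (SUP f\<in>subordinate U. ennreal (I f))"

definition outer :: "'b set \<Rightarrow> ennreal" where
  "outer E = (INF U\<in>{U. E \<subseteq> U \<and> openin T U}. mass U)"

lemma zero_subordinate: "(\<lambda>x. 0) \<in> subordinate U"
  by (auto simp: subordinate_def const_closed)

lemma subordinate_nonempty: "subordinate U \<noteq> {}"
  using zero_subordinate by blast

lemma subordinateD:
  assumes "f \<in> subordinate U"
  shows "f \<in> A" "x \<in> topspace T \<Longrightarrow> 0 \<le> f x" "x \<in> topspace T \<Longrightarrow> f x \<le> 1"
    "x \<in> topspace T \<Longrightarrow> x \<notin> U \<Longrightarrow> f x = 0" "0 \<le> I f"
  using assms by (auto simp: subordinate_def intro!: I_nonneg)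

lemma le_mass: "f \<in> subordinate U \<Longrightarrow> ennreal (I f) \<le> mass U"
  unfolding mass_def by (rule SUP_upper)

lemma mass_mono: "U \<subseteq> V \<Longrightarrow> mass U \<le> mass V"
  unfolding mass_def by (rule SUP_subset_mono) (auto simp: subordinate_def)

lemma mass_topspace: "mass (topspace T) = 1"
proof (rule antisym)
  show "mass (topspace T) \<le> 1"
    unfolding mass_def
  proof (rule SUP_least)
    fix f assume "f \<in> subordinate (topspace T)"
    note f = subordinateD[OF this]
    show "ennreal (I f) \<le> 1"
      using I_mono[OF f(1) one_closed f(3)] I_one f(5) by simp
  qed
  have "(\<lambda>x. 1) \<in> subordinate (topspace T)"
    by (auto simp: subordinate_def one_closed)
  from le_mass[OF this] show "1 \<le> mass (topspace T)"
    by (simp add: I_one)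
qed

lemma mass_empty: "mass {} = 0"
proof -
  have "mass {} \<le> 0"
    unfolding mass_def
  proof (rule SUP_least)
    fix f assume f: "f \<in> subordinate {}"
    have "I f \<le> I (\<lambda>x. 0)"
      using subordinateD(4)[OF f] by (intro I_mono const_closed subordinateD(1)[OF f]) auto
    then show "ennreal (I f) \<le> 0" by (simp add: I_const ennreal_neg)
  qed
  then show ?thesis by simp
qed

text \<open>Cutting off below by \<open>e\<close> makes the support compact at the cost of at most \<open>e\<close>.\<close>

lemma cutoff:
  assumes f: "f \<in> subordinate U" and "0 < e"
  shows "compactin T {x \<in> topspace T. f x \<ge> e}" "{x \<in> topspace T. f x \<ge> e} \<subseteq> U"
    "(\<lambda>x. max (f x - e) 0) \<in> subordinate {x \<in> topspace T. f x \<ge> e}"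
    "I f \<le> I (\<lambda>x. max (f x - e) 0) + e"
proof -
  note fD = subordinateD[OF f]
  show "compactin T {x \<in> topspace T. f x \<ge> e}"
    by (intro closedin_compact_space compact closedin_ge fD)
  show "{x \<in> topspace T. f x \<ge> e} \<subseteq> U"
    using fD(4) \<open>0 < e\<close> by force
  have g: "(\<lambda>x. max (f x - e) 0) \<in> A"
    by (intro lattice_closed fD)
  show "(\<lambda>x. max (f x - e) 0) \<in> subordinate {x \<in> topspace T. f x \<ge> e}"
    using g fD(2,3) \<open>0 < e\<close> by (force simp: subordinate_def)
  have "I f \<le> I (\<lambda>x. max (f x - e) 0 + e)"
    by (intro I_mono lattice_closed fD(1)) auto
  then show "I f \<le> I (\<lambda>x. max (f x - e) 0) + e"
    using I_add[OF g const_closed[of e]] I_const[of e] by simp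
qed

lemma cutoff_le:
  assumes f: "f \<in> subordinate U" and e: "0 < e"
  shows "ennreal (I f) \<le> mass {x \<in> topspace T. f x \<ge> e} + ennreal e"
proof -
  note c = cutoff[OF f e]
  have "ennreal (I f) \<le> ennreal (I (\<lambda>x. max (f x - e) 0)) + ennreal e"
    using ennreal_leI[OF c(4)] e subordinateD(5)[OF c(3)] by simp
  also have "\<dots> \<le> mass {x \<in> topspace T. f x \<ge> e} + ennreal e"
    by (intro add_right_mono le_mass c(3))
  finally show ?thesis .
qed

text \<open>After the cutoff, the part of the superlevel set outside \<open>V\<close> is compact and
  contained in \<open>U\<close>, so some \<open>g\<close> equals 1 there and vanishes off
  \<open>U\<close>. The cut-off function splits into its minimum with \<open>g\<close>, which lives
  in \<open>U\<close>, and the remainder, which lives in \<open>V\<close>: off \<open>V\<close>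
  either \<open>g\<close> is 1 and the minimum is the whole function, or the function is already
  0.\<close>

lemma mass_Un:
  assumes U: "openin T U" and V: "openin T V"
  shows "mass (U \<union> V) \<le> mass U + mass V"
  unfolding mass_def[of "U \<union> V"]
proof (rule SUP_least, rule ennreal_le_epsilon)
  fix f and e :: real assume f: "f \<in> subordinate (U \<union> V)" and e: "0 < e"
  let ?K = "{x \<in> topspace T. f x \<ge> e}" and ?f = "\<lambda>x. max (f x - e) 0"
  note c = cutoff[OF f e] and fe = subordinateD[OF cutoff(3)[OF f e]]
  have "compactin T (?K - V)"
    by (rule closed_compactin[OF c(1)])
      (auto intro!: closedin_diff closedin_ge V subordinateD(1)[OF f])
  then obtain g where g: "g \<in> A" "\<And>x. 0 \<le> g x" "\<And>x. g x \<le> 1"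
    "\<And>x. x \<in> ?K - V \<Longrightarrow> g x = 1" "\<And>x. x \<in> topspace T - U \<Longrightarrow> g x = 0"
    using urysohn_open[OF _ U] c(2) by blast
  have A: "(\<lambda>x. min (?f x) (g x)) \<in> A" "(\<lambda>x. ?f x - min (?f x) (g x)) \<in> A"
    by (intro lattice_closed g(1) fe(1))+
  have "(\<lambda>x. min (?f x) (g x)) \<in> subordinate U"
    using A(1) fe(2) g by (auto simp: subordinate_def min_le_iff_disj)
  moreover have "(\<lambda>x. ?f x - min (?f x) (g x)) \<in> subordinate V"
    unfolding subordinate_def
  proof (intro CollectI conjI ballI impI A(2))
    fix x assume x: "x \<in> topspace T"
    show "?f x - min (?f x) (g x) \<le> 1" "0 \<le> ?f x - min (?f x) (g x)"
      using fe(3)[OF x] g(2)[of x] by (auto simp: min_def)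
    assume "x \<notin> V"
    then show "?f x - min (?f x) (g x) = 0"
      using fe(3)[OF x] fe(4)[OF x] g(2)[of x] g(4)[of x] x by (cases "x \<in> ?K") (auto simp: min_def)
  qed
  moreover have "I f \<le> I (\<lambda>x. min (?f x) (g x)) + I (\<lambda>x. ?f x - min (?f x) (g x)) + e"
    using c(4) I_diff[OF fe(1) A(1)] by simp
  ultimately have le: "ennreal (I (\<lambda>x. min (?f x) (g x))) \<le> mass U"
    "ennreal (I (\<lambda>x. ?f x - min (?f x) (g x))) \<le> mass V"
    "ennreal (I f) \<le> ennreal (I (\<lambda>x. min (?f x) (g x))) + ennreal (I (\<lambda>x. ?f x - min (?f x) (g x))) + ennreal e"
    using e by (auto intro: le_mass ennreal_leI simp: subordinateD(5) simp flip: ennreal_plus)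
  then show "ennreal (I f) \<le> mass U + mass V + ennreal e"
    using order_trans[OF le(3) add_right_mono[OF add_mono[OF le(1,2)]]] by simp
qed

lemma mass_UN_finite:
  fixes n :: nat
  assumes "\<And>i. openin T (U i)"
  shows "mass (\<Union>i<n. U i) \<le> (\<Sum>i<n. mass (U i))"
proof (induction n)
  case (Suc n)
  have "mass (\<Union>i<Suc n. U i) \<le> mass (\<Union>i<n. U i) + mass (U n)"
    using mass_Un[OF openin_Union assms, of "U ` {..<n}"] assms by (auto simp: lessThan_Suc Un_commute)
  also have "\<dots> \<le> (\<Sum>i<Suc n. mass (U i))"
    using add_right_mono[OF Suc, of "mass (U n)"] by simp
  finally show ?case .
qed (simp add: mass_empty)

text \<open>A function subordinate to the union has, up to \<open>e\<close>, a compact superlevel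
  set as its support, and this set meets the cover in finitely many members; the infinite case thus
  reduces to finite subadditivity.\<close>

lemma mass_UN:
  fixes U :: "nat \<Rightarrow> 'b set"
  assumes U: "\<And>i. openin T (U i)"
  shows "mass (\<Union>i. U i) \<le> (\<Sum>i. mass (U i))"
  unfolding mass_def[of "\<Union>i. U i"]
proof (rule SUP_least, rule ennreal_le_epsilon)
  fix f and e :: real assume f: "f \<in> subordinate (\<Union>i. U i)" and e: "0 < e"
  let ?K = "{x \<in> topspace T. f x \<ge> e}"
  note c = cutoff[OF f e]
  have "\<exists>\<F>. finite \<F> \<and> \<F> \<subseteq> range U \<and> ?K \<subseteq> \<Union>\<F>"
    by (rule compactinD[OF c(1) _ c(2)]) (use U in blast)
  then obtain \<F> where \<F>: "finite \<F>" "\<F> \<subseteq> range U" "?K \<subseteq> \<Union>\<F>"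
    by (elim exE conjE)
  then obtain J where "finite J" "\<F> = U ` J"
    using finite_subset_image[OF \<F>(1,2)] by (elim exE conjE)
  with \<F>(3) have J: "finite J" "?K \<subseteq> (\<Union>i\<in>J. U i)"
    by simp_all
  obtain n where "J \<subseteq> {..<n}"
    using finite_nat_iff_bounded J(1) by auto
  with J have "?K \<subseteq> (\<Union>i<n. U i)" by blast
  from mass_mono[OF this] have "mass ?K \<le> (\<Sum>i<n. mass (U i))"
    using mass_UN_finite[OF U] by (rule order_trans)
  also have "\<dots> \<le> (\<Sum>i. mass (U i))"
    by (intro sum_le_suminf) auto
  finally show "ennreal (I f) \<le> (\<Sum>i. mass (U i)) + ennreal e"
    using order_trans[OF cutoff_le[OF f e] add_right_mono] by simp
qed

lemma outer_open: "openin T U \<Longrightarrow> outer U = mass U"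
  unfolding outer_def by (intro antisym INF_greatest INF_lower mass_mono) auto

lemma outer_mono: "E \<subseteq> F \<Longrightarrow> outer E \<le> outer F"
  unfolding outer_def by (rule INF_superset_mono) auto

lemma outer_le: "E \<subseteq> U \<Longrightarrow> openin T U \<Longrightarrow> outer E \<le> mass U"
  unfolding outer_def by (rule INF_lower) auto

lemma outer_close:
  assumes "outer E < c"
  obtains U where "E \<subseteq> U" "openin T U" "mass U < c"
  using assms unfolding outer_def INF_less_iff by blast

lemma outer_UN:
  fixes E :: "nat \<Rightarrow> 'b set"
  shows "outer (\<Union>i. E i) \<le> (\<Sum>i. outer (E i))"
proof (rule ennreal_le_epsilon)
  \<comment> \<open>Finiteness of the sum makes every \<open>outer (E i)\<close> finite, so adding a
    positive amount is a strict increase and an open superset can be chosen below it. The increments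
    e / 2^(i+1) add up to \<open>e\<close>.\<close>
  fix e :: real assume e: "0 < e" and "(\<Sum>i. outer (E i)) < top_class.top"
  then have lt: "outer (E i) < outer (E i) + e * (1/2) ^ Suc i" for i
    by (auto simp add: less_top dest!: ennreal_suminf_lessD)
  have "\<exists>U. E i \<subseteq> U \<and> openin T U \<and> mass U < outer (E i) + e * (1/2) ^ Suc i" for i
    by (rule outer_close[OF lt]) blast
  then obtain U where U: "\<And>i. E i \<subseteq> U i" "\<And>i. openin T (U i)"
    "\<And>i. mass (U i) < outer (E i) + e * (1/2) ^ Suc i"
    by metis
  have "outer (\<Union>i. E i) \<le> mass (\<Union>i. U i)"
    using U by (intro outer_le) auto
  also have "\<dots> \<le> (\<Sum>i. mass (U i))"
    by (rule mass_UN[OF U(2)])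
  also have "\<dots> \<le> (\<Sum>i. outer (E i) + e * (1/2) ^ Suc i)"
    by (intro suminf_le less_imp_le U) auto
  also have "\<dots> = (\<Sum>i. outer (E i)) + (\<Sum>i. ennreal e * ennreal ((1/2) ^ Suc i))"
    using e by (subst suminf_add[symmetric])
      (auto simp del: ennreal_suminf_cmult simp add: ennreal_mult[symmetric])
  also have "\<dots> = (\<Sum>i. outer (E i)) + e"
    unfolding ennreal_suminf_cmult
    by (subst suminf_ennreal_eq[OF zero_le_power power_half_series]) auto
  finally show "outer (\<Union>i. E i) \<le> (\<Sum>i. outer (E i)) + e" .
qed

lemma outer_measure_space_outer: "outer_measure_space (Pow (topspace T)) outer"
  unfolding outer_measure_space_def positive_def increasing_def countably_subadditive_def
  using outer_open[of "{}"] mass_empty by (simp add: outer_mono outer_UN)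

text \<open>Let \<open>f\<close> be subordinate to the intersection of \<open>U\<close> and
  \<open>V\<close>, cut off so that it lives on a compact set \<open>?K\<close> inside both. The
  open set \<open>?W\<close>, which is \<open>U\<close> without \<open>?K\<close>, still covers E -
  V. A function \<open>h\<close> subordinate to \<open>?W\<close> vanishes on \<open>?K\<close>, so
  the cut-off function plus \<open>h\<close> stays below 1 and is subordinate to \<open>U\<close>.
  Taking suprema over \<open>h\<close> and then over \<open>f\<close>, and the infimum over
  \<open>U\<close>, yields the nontrivial Caratheodory inequality.\<close>

lemma open_lambda_system:
  assumes V: "openin T V"
  shows "V \<in> lambda_system (topspace T) (Pow (topspace T)) outer"
proof -
  have main: "outer (E \<inter> V) + outer (E - V) \<le> mass U" if U: "E \<subseteq> U" "openin T U" for E U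
  proof -
    have "ennreal (I f) + outer (E - V) \<le> mass U" if f: "f \<in> subordinate (U \<inter> V)" for f
    proof (rule ennreal_le_epsilon)
      fix e :: real assume e: "0 < e"
      let ?K = "{x \<in> topspace T. f x \<ge> e}" and ?f = "\<lambda>x. max (f x - e) 0"
      note c = cutoff[OF f e] and fe = subordinateD[OF cutoff(3)[OF f e]]
      let ?W = "U - ?K"
      have W: "openin T ?W"
        by (intro openin_diff U closedin_ge subordinateD(1)[OF f])
      have "ennreal (I ?f) + mass ?W \<le> mass U"
      proof -
        have "ennreal (I ?f) + ennreal (I h) \<le> mass U" if h: "h \<in> subordinate ?W" for h
        proof -
          note hD = subordinateD[OF h]
          have "(\<lambda>x. ?f x + h x) \<in> subordinate U"
            unfolding subordinate_def
          proof (intro CollectI conjI ballI impI add_closed fe(1) hD(1))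
            fix x assume x: "x \<in> topspace T"
            show "0 \<le> ?f x + h x" using hD(2)[OF x] by simp
            show "?f x + h x \<le> 1"
              using hD(3,4)[OF x] fe(3,4)[OF x] by (cases "x \<in> ?K") auto
            show "?f x + h x = 0" if "x \<notin> U"
              using hD(4)[OF x] fe(4)[OF x] that c(2) by auto
          qed
          from le_mass[OF this] show ?thesis
            using hD(5) fe(5) I_add[OF fe(1) hD(1)] by simp
        qed
        then show ?thesis
          unfolding mass_def[of ?W]
          by (subst ennreal_SUP_add_right[OF subordinate_nonempty]) (rule SUP_least)
      qed
      moreover have "outer (E - V) \<le> mass ?W"
        using U(1) c(2) by (intro outer_le W) auto
      moreover have "ennreal (I f) \<le> ennreal (I ?f) + e"
        using ennreal_leI[OF c(4)] fe(5) e by simp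
      ultimately have "ennreal (I f) + outer (E - V) \<le> (ennreal (I ?f) + mass ?W) + ennreal e"
        using add_mono[of "ennreal (I f)" "ennreal (I ?f) + e" "outer (E - V)" "mass ?W"]
        by (simp add: ac_simps)
      also have "\<dots> \<le> mass U + ennreal e"
        by (rule add_right_mono) fact
      finally show "ennreal (I f) + outer (E - V) \<le> mass U + ennreal e" .
    qed
    then have "mass (U \<inter> V) + outer (E - V) \<le> mass U"
      unfolding mass_def[of "U \<inter> V"]
      by (subst ennreal_SUP_add_left[OF subordinate_nonempty, symmetric]) (rule SUP_least)
    moreover have "outer (E \<inter> V) \<le> mass (U \<inter> V)"
      using U V by (intro outer_le) auto
    ultimately show ?thesis
      using order_trans[OF add_right_mono] by blast
  qed
  show ?thesis
    unfolding algebra.lambda_system_eq[OF algebra_Pow]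
  proof (intro CollectI conjI ballI)
    fix E assume E: "E \<in> Pow (topspace T)"
    have "subadditive (Pow (topspace T)) outer"
      using outer_measure_space_outer unfolding outer_measure_space_def
      by (intro ring_of_sets.countably_subadditive_subadditive[OF ring_of_sets_Pow]) auto
    from subadditiveD[OF this, of "E \<inter> V" "E - V"] E
    have "outer E \<le> outer (E \<inter> V) + outer (E - V)"
      by (auto simp: Int_Diff_Un)
    moreover have "outer (E \<inter> V) + outer (E - V) \<le> outer E"
      unfolding outer_def[of E] by (rule INF_greatest) (use main in auto)
    ultimately show "outer (E \<inter> V) + outer (E - V) = outer E"
      by simp
  qed (use openin_subset[OF V] in auto)
qed

section \<open>The representing measure and its regularity\<close>

definition riesz :: "'b measure" where
  "riesz = measure_of (topspace T) {U. openin T U} outer"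

lemma sets_riesz: "sets riesz = sets (borel_of_top T)"
  unfolding sets_borel_of_top riesz_def by (rule sets_measure_of) (auto dest: openin_subset)

lemma space_riesz: "space riesz = topspace T"
  by (simp add: riesz_def space_measure_of_conv)

text \<open>\<open>measure_of\<close> keeps the prescribed values only for a function that is
  countably additive on the generated sets. Caratheodory's theorem gives this on the lambda system,
  which contains the open sets and hence all Borel sets.\<close>

lemma emeasure_riesz:
  assumes "E \<in> sets riesz"
  shows "emeasure riesz E = outer E"
proof -
  let ?L = "lambda_system (topspace T) (Pow (topspace T)) outer"
  have L: "measure_space (topspace T) ?L outer"
    by (rule sigma_algebra.caratheodory_lemma[OF sigma_algebra_Pow outer_measure_space_outer])
  then have "sigma_sets (topspace T) {U. openin T U} \<subseteq> ?L"
    by (intro sigma_algebra.sigma_sets_subset) (auto simp: measure_space_def open_lambda_system)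
  then have "measure_space (topspace T) (sets riesz) outer"
    using measure_down[OF L, of "sets riesz"] sets.sigma_algebra_axioms[of riesz]
    by (simp add: sets_riesz sets_borel_of_top space_riesz)
  then show ?thesis
    using assms by (intro emeasure_measure_of[OF riesz_def]) (auto simp: measure_space_def dest: openin_subset)
qed

lemma emeasure_riesz_open: "openin T U \<Longrightarrow> emeasure riesz U = mass U"
  by (simp add: emeasure_riesz sets_riesz openin_borel_of_top outer_open)

lemma prob_space_riesz: "prob_space riesz"
  by (rule prob_spaceI) (simp add: space_riesz emeasure_riesz_open mass_topspace)

text \<open>Outer regularity is built into \<open>outer\<close>. Inner regularity is its mirror
  image under complements: if an open \<open>U\<close> covers the complement of \<open>E\<close>
  with excess below \<open>e\<close>, then the complement of \<open>U\<close> is closed, hence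
  compact, lies in \<open>E\<close>, and misses less than \<open>e\<close> of it.\<close>

lemma regular_riesz: "regular_borel_prob T riesz"
  unfolding regular_borel_prob_def
proof (intro conjI ballI sets_riesz prob_space_riesz)
  interpret prob_space riesz by (rule prob_space_riesz)
  have outer_reg: "emeasure riesz E = (INF U\<in>{U. E \<subseteq> U \<and> openin T U}. emeasure riesz U)"
    if "E \<in> sets riesz" for E
    unfolding emeasure_riesz[OF that] outer_def
    by (rule INF_cong) (auto simp: emeasure_riesz_open)
  fix E assume E: "E \<in> sets riesz"
  show "emeasure riesz E = (INF U\<in>{U. E \<subseteq> U \<and> openin T U}. emeasure riesz U)"
    by (rule outer_reg[OF E])
  show "emeasure riesz E = (SUP K\<in>{K. K \<subseteq> E \<and> compactin T K \<and> K \<in> sets riesz}. emeasure riesz K)"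
    (is "_ = ?S")
  proof (rule antisym)
    show "?S \<le> emeasure riesz E"
      using E by (intro SUP_least emeasure_mono) auto
    show "emeasure riesz E \<le> ?S"
    proof (rule ennreal_le_epsilon)
      fix e :: real assume e: "0 < e"
      let ?C = "topspace T - E"
      have C: "?C \<in> sets riesz" using E sets.compl_sets[OF E] by (simp add: space_riesz)
      have "outer ?C < emeasure riesz ?C + e"
        using e C emeasure_finite[of ?C] by (simp add: emeasure_riesz less_top[symmetric] ennreal_add_left_cancel_less)
      then obtain U where U: "?C \<subseteq> U" "openin T U" "mass U < emeasure riesz ?C + e"
        by (rule outer_close)
      let ?K = "topspace T - U"
      have sets: "U \<in> sets riesz" "?K \<in> sets riesz"
        using U(2) openin_borel_of_top[OF U(2)] closedin_borel_of_top[of T ?K] by (auto simp: sets_riesz)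
      have "measure riesz U < measure riesz ?C + e"
        using U(3) e by (simp add: emeasure_riesz_open[OF U(2), symmetric] emeasure_eq_measure
          ennreal_plus[symmetric] ennreal_less_iff del: ennreal_plus)
      then have "measure riesz E \<le> measure riesz ?K + e"
        using prob_compl[OF E] prob_compl[OF sets(1)] by (simp add: space_riesz)
      then have "emeasure riesz E \<le> emeasure riesz ?K + e"
        using e by (simp add: emeasure_eq_measure ennreal_plus[symmetric] ennreal_leI del: ennreal_plus)
      also have "emeasure riesz ?K \<le> ?S"
        using U sets by (intro SUP_upper) (auto intro!: closedin_compact_space compact)
      finally show "emeasure riesz E \<le> ?S + e" by (simp add: add_right_mono)
    qed
  qed
qed

section \<open>Integration against the representing measure\<close>

lemma I_le_riesz:
  assumes g: "g \<in> A" "\<And>x. x \<in> topspace T \<Longrightarrow> 0 \<le> g x" "\<And>x. x \<in> topspace T \<Longrightarrow> g x \<le> c"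
    and U: "openin T U" "\<And>x. x \<in> topspace T \<Longrightarrow> x \<notin> U \<Longrightarrow> g x = 0" and c: "0 < c"
  shows "I g \<le> c * measure riesz U"
proof -
  interpret prob_space riesz by (rule prob_space_riesz)
  have "(\<lambda>x. (1 / c) * g x) \<in> subordinate U"
    unfolding subordinate_def
    using g(2,3) U c scale_closed[OF g(1), of "1 / c"] by (auto simp: divide_le_eq_1)
  from le_mass[OF this] have "ennreal (I g / c) \<le> measure riesz U"
    using I_scale[OF g(1), of "1 / c"] by (simp add: emeasure_riesz_open[OF U(1), symmetric] emeasure_eq_measure)
  then have "I g / c \<le> measure riesz U" by simp
  then show ?thesis using c by (simp add: divide_simps mult.commute)
qed

text \<open>Markov's inequality. It bounds integrals of layers from below, whereas
  \<open>I_le_riesz\<close> bounds their values under \<open>I\<close> from above.\<close>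

lemma riesz_le_integral:
  assumes g: "g \<in> A" "\<And>x. x \<in> topspace T \<Longrightarrow> 0 \<le> g x"
    and U: "U \<in> sets riesz" "\<And>x. x \<in> U \<Longrightarrow> c \<le> g x"
  shows "c * measure riesz U \<le> integral\<^sup>L riesz g"
proof -
  interpret prob_space riesz by (rule prob_space_riesz)
  have "c * measure riesz U = (\<integral>x. c * indicator U x \<partial>riesz)"
    using U(1) sets.sets_into_space[OF U(1)] by (simp add: Int_absorb1)
  also have "\<dots> \<le> integral\<^sup>L riesz g"
  proof (rule integral_mono)
    show "integrable riesz (\<lambda>x. c * indicator U x)"
      using U(1) by (intro integrable_mult_right integrable_real_indicator) (simp_all add: less_top[symmetric])
  qed (use U g integrable_lattice[OF regular_riesz g(1)] in \<open>auto simp: space_riesz indicator_def\<close>)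
  finally show ?thesis .
qed

text \<open>Slicing \<open>f\<close> into layers of height \<open>1 / n\<close> compares both sides with the
  measures of the superlevel sets; the two bounds differ by a shift of the index.\<close>

lemma I_le_integral:
  assumes f: "f \<in> A" "\<And>x. x \<in> topspace T \<Longrightarrow> 0 \<le> f x" "\<And>x. x \<in> topspace T \<Longrightarrow> f x \<le> 1"
  shows "I f \<le> integral\<^sup>L riesz f"
proof -
  interpret prob_space riesz by (rule prob_space_riesz)
  have le: "I f \<le> integral\<^sup>L riesz f + 1 / real n" if n: "0 < n" for n :: nat
  proof -
    define g where "g k x = min (f x) (real (Suc k) / n) - min (f x) (real k / n)" for k x
    define a where "a k = measure riesz {x \<in> topspace T. f x > real k / n}" for k
    have gA: "g k \<in> A" for k
      unfolding g_def by (intro lattice_closed f)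
    have g0: "0 \<le> g k x" and g1: "g k x \<le> 1 / n" for k x
      using n by (auto simp: g_def min_def divide_simps)
    have I_g: "I (g k) \<le> 1 / n * a k" for k
      unfolding a_def using n g0 g1 divide_right_mono[of k "Suc k" n]
      \<comment> \<open>The layer \<open>g k\<close> vanishes where f is at most k / n. In
        \<open>int_g\<close> the set has the next index instead, because the layer reaches its full
        height 1 / n only where f exceeds (k + 1) / n.\<close>
      by (intro I_le_riesz gA openin_greater f(1)) (auto simp: g_def min_def)
    have int_g: "1 / n * a (Suc k) \<le> integral\<^sup>L riesz (g k)" for k
      unfolding a_def
    proof (intro riesz_le_integral gA g0)
      show "{x \<in> topspace T. f x > real (Suc k) / n} \<in> sets riesz"
        unfolding sets_riesz by (intro openin_borel_of_top openin_greater f(1))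
    qed (use n in \<open>auto simp: g_def min_def divide_simps\<close>)
    have sum_g: "(\<Sum>k<n. g k x) = f x" if "x \<in> topspace T" for x
    proof -
      have "(\<Sum>k<n. g k x) = min (f x) (real n / n) - min (f x) (real 0 / n)"
        unfolding g_def by (rule sum_lessThan_telescope)
      then show ?thesis using n f(2,3)[OF that] by simp
    qed
    have sumA: "(\<lambda>x. \<Sum>k<n. g k x) \<in> A" "I (\<lambda>x. \<Sum>k<n. g k x) = (\<Sum>k<n. I (g k))"
      using sum_closed[of n g] gA by auto
    have "I f \<le> (\<Sum>k<n. I (g k))"
      unfolding sumA(2)[symmetric] by (intro I_mono f(1) sumA(1)) (simp add: sum_g)
    also have "\<dots> \<le> (\<Sum>k<n. 1 / n * a k)"
      by (intro sum_mono I_g)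
    \<comment> \<open>The extra term k = n allows the shift of the index: the term with
      \<open>a 0\<close>, at most 1 / n, is split off, and each remaining \<open>a (Suc k)\<close>
      is controlled by \<open>int_g\<close>.\<close>
    also have "\<dots> \<le> (\<Sum>k<Suc n. 1 / n * a k)"
      using n by (simp add: a_def)
    also have "\<dots> = 1 / n * a 0 + (\<Sum>k<n. 1 / n * a (Suc k))"
      by (rule sum.lessThan_Suc_shift)
    also have "\<dots> \<le> 1 / n + (\<Sum>k<n. integral\<^sup>L riesz (g k))"
      using n by (intro add_mono sum_mono int_g) (auto simp: a_def divide_simps)
    also have "(\<Sum>k<n. integral\<^sup>L riesz (g k)) = integral\<^sup>L riesz (\<lambda>x. \<Sum>k<n. g k x)"
      by (intro Bochner_Integration.integral_sum[symmetric] integrable_lattice regular_riesz gA)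
    also have "\<dots> = integral\<^sup>L riesz f"
      by (intro Bochner_Integration.integral_cong) (auto simp: space_riesz sum_g)
    finally show ?thesis by simp
  qed
  show ?thesis
  proof (rule field_le_epsilon)
    fix e :: real assume "0 < e"
    then obtain n :: nat where "0 < n" "1 / real n < e"
      by (metis nat_approx_posE zero_less_Suc)
    then show "I f \<le> integral\<^sup>L riesz f + e" using le[of n] by simp
  qed
qed

text \<open>Applying \<open>I_le_integral\<close> to g and to 1 - g gives equality for functions
  with values in [0, 1], because both functionals send 1 to 1. A function bounded by
  \<open>B\<close> is carried into [0, 1] by the affine map t to (t + B) / (2 B).\<close>

lemma integral_riesz:
  assumes f: "f \<in> A"
  shows "integral\<^sup>L riesz f = I f"
proof -
  interpret prob_space riesz by (rule prob_space_riesz)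
  note int = integrable_lattice[OF regular_riesz]
  have unit: "integral\<^sup>L riesz g = I g"
    if g: "g \<in> A" "\<And>x. x \<in> topspace T \<Longrightarrow> 0 \<le> g x" "\<And>x. x \<in> topspace T \<Longrightarrow> g x \<le> 1" for g
  proof (rule antisym)
    have "I (\<lambda>x. 1 - g x) \<le> integral\<^sup>L riesz (\<lambda>x. 1 - g x)"
      using g by (intro I_le_integral lattice_closed) auto
    then show "integral\<^sup>L riesz g \<le> I g"
      using int[OF g(1)] by (simp add: I_diff const_closed g(1) I_const prob_space)
  qed (rule I_le_integral[OF g])
  obtain B where B: "0 < B" "\<And>x. x \<in> topspace T \<Longrightarrow> \<bar>f x\<bar> \<le> B"
    using bounded_closed[OF f] by blast
  have "integral\<^sup>L riesz (\<lambda>x. (1 / (2 * B)) * (f x + B)) = I (\<lambda>x. (1 / (2 * B)) * (f x + B))"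
    using B by (intro unit lattice_closed f) (fastforce simp: divide_simps abs_le_iff)+
  moreover have "I (\<lambda>x. (1 / (2 * B)) * (f x + B)) = (1 / (2 * B)) * (I f + B)"
    by (subst I_scale) (auto intro!: lattice_closed f simp: I_add f const_closed I_const)
  moreover have "integral\<^sup>L riesz (\<lambda>x. (1 / (2 * B)) * (f x + B)) = (1 / (2 * B)) * (integral\<^sup>L riesz f + B)"
    using int[OF f] by (subst integral_mult_right_zero) (simp add: prob_space)
  ultimately show ?thesis using B(1) by simp
qed

section \<open>Uniqueness of the representing measure\<close>

lemma regular_open_eq_mass:
  assumes m: "regular_borel_prob T m" and int: "\<And>f. f \<in> A \<Longrightarrow> integral\<^sup>L m f = I f"
    and U: "openin T U"
  shows "emeasure m U = mass U"
proof (rule antisym)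
  interpret prob_space m using regular_borel_probD(2)[OF m] .
  note D = regular_borel_probD[OF m]
  have Um: "U \<in> sets m" using U by (simp add: D(1) openin_borel_of_top)
  \<comment> \<open>A function subordinate to \<open>U\<close> lies below the indicator of
    \<open>U\<close>.\<close>
  show "mass U \<le> emeasure m U"
    unfolding mass_def
  proof (rule SUP_least)
    fix f assume "f \<in> subordinate U"
    note f = subordinateD[OF this]
    have "I f \<le> (\<integral>x. indicator U x \<partial>m)"
      unfolding int[OF f(1), symmetric] using f Um
      by (intro integral_mono integrable_lattice[OF m f(1)] integrable_real_indicator)
        (auto simp: D(3) indicator_def less_top[symmetric])
    then show "ennreal (I f) \<le> emeasure m U"
      using Um sets.sets_into_space[OF Um] by (simp add: emeasure_eq_measure Int_absorb1 ennreal_leI)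
  qed
  \<comment> \<open>By inner regularity it suffices to bound compact subsets of \<open>U\<close>; a
    Urysohn function lies above the indicator of such a set and is subordinate to
    \<open>U\<close>.\<close>
  show "emeasure m U \<le> mass U"
    unfolding D(5)[OF Um]
  proof (rule SUP_least, clarify)
    fix K assume K: "K \<subseteq> U" "compactin T K" "K \<in> sets m"
    obtain f where f: "f \<in> A" "\<And>x. 0 \<le> f x" "\<And>x. f x \<le> 1"
      "\<And>x. x \<in> K \<Longrightarrow> f x = 1" "\<And>x. x \<in> topspace T - U \<Longrightarrow> f x = 0"
      using urysohn_open[OF K(2) U K(1)] by metis
    have "(\<integral>x. indicator K x \<partial>m) \<le> I f"
      unfolding int[OF f(1), symmetric] using f K(3)
      by (intro integral_mono integrable_lattice[OF m f(1)] integrable_real_indicator)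
        (auto simp: D(3) indicator_def less_top[symmetric])
    then have "emeasure m K \<le> ennreal (I f)"
      using K(3) sets.sets_into_space[OF K(3)] by (simp add: emeasure_eq_measure Int_absorb1 ennreal_leI)
    also have "\<dots> \<le> mass U"
      using f by (intro le_mass) (auto simp: subordinate_def)
    finally show "emeasure m K \<le> mass U" .
  qed
qed

text \<open>Outer regularity determines the measure from its values on open sets, and
  \<open>regular_open_eq_mass\<close> expresses those through \<open>I\<close>.\<close>

theorem riesz_unique:
  assumes "regular_borel_prob T m" "\<And>f. f \<in> A \<Longrightarrow> integral\<^sup>L m f = I f"
  shows "m = riesz"
proof (rule measure_eqI)
  note D = regular_borel_probD[OF assms(1)]
  show "sets m = sets riesz" by (simp add: D(1) sets_riesz)
  fix E assume E: "E \<in> sets m"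
  then have "emeasure riesz E = outer E"
    by (simp add: emeasure_riesz D(1) sets_riesz)
  then show "emeasure m E = emeasure riesz E"
    unfolding D(4)[OF E] outer_def by (auto intro!: INF_cong regular_open_eq_mass[OF assms])
qed

end

section \<open>The Samuel compactification\<close>

text \<open>The record \<open>uspace\<close> carries no axioms. Intersections serve to combine two
  functions, existence of an entourage serves for constants, and containment in the square of the
  points keeps the value \<open>undefined\<close> of extensional functions out of the
  estimates.\<close>

locale filtered_uspace =
  fixes X :: "('a, 'z) uspace_scheme"
  assumes entourage_subset: "V \<in> entourages X \<Longrightarrow> V \<subseteq> points X \<times> points X"
    and entourage_Int: "V \<in> entourages X \<Longrightarrow> W \<in> entourages X \<Longrightarrow> \<exists>Z\<in>entourages X. Z \<subseteq> V \<inter> W"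
    and entourage_ex: "\<exists>V. V \<in> entourages X"
begin

lemma UCB_bounded:
  assumes "f \<in> UCB X"
  obtains B where "0 < B" "\<And>x. x \<in> points X \<Longrightarrow> \<bar>f x\<bar> \<le> B"
  using assms that unfolding UCB_def bounded_pos by auto

lemma UCB_entourage:
  assumes "f \<in> UCB X" "0 < e"
  obtains V where "V \<in> entourages X" "\<And>x y. (x, y) \<in> V \<Longrightarrow> \<bar>f x - f y\<bar> < e"
  using assms that unfolding UCB_def by blast

text \<open>The pair (f, g) takes its values in a compact box, on which \<phi> is uniformly
  continuous; the distance of two pairs is at most the sum of the coordinate distances, hence the
  two halves of \<open>d\<close>. All algebraic closure properties of \<open>UCB X\<close> are
  instances.\<close>

lemma UCB_comp2:
  fixes \<phi> :: "real \<times> real \<Rightarrow> real"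
  assumes f: "f \<in> UCB X" and g: "g \<in> UCB X" and \<phi>: "continuous_on UNIV \<phi>"
  shows "(\<lambda>x\<in>points X. \<phi> (f x, g x)) \<in> UCB X"
proof -
  obtain A where A: "0 < A" "\<And>x. x \<in> points X \<Longrightarrow> \<bar>f x\<bar> \<le> A" using UCB_bounded[OF f] by blast
  obtain B where B: "0 < B" "\<And>x. x \<in> points X \<Longrightarrow> \<bar>g x\<bar> \<le> B" using UCB_bounded[OF g] by blast
  let ?K = "{-A..A} \<times> {-B..B}"
  have K: "compact ?K" by (intro compact_Times compact_Icc)
  have mem: "(f x, g x) \<in> ?K" if "x \<in> points X" for x
    using A(2)[OF that] B(2)[OF that] by (auto simp: abs_le_iff)
  have cont: "continuous_on ?K \<phi>" using continuous_on_subset[OF \<phi>] by blast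
  have "bounded (\<phi> ` ?K)"
    using compact_continuous_image[OF cont K] compact_imp_bounded by blast
  then have bdd: "bounded ((\<lambda>x\<in>points X. \<phi> (f x, g x)) ` points X)"
    by (rule bounded_subset) (use mem in auto)
  have "\<exists>V\<in>entourages X. \<forall>(x, y)\<in>V.
      \<bar>(\<lambda>x\<in>points X. \<phi> (f x, g x)) x - (\<lambda>x\<in>points X. \<phi> (f x, g x)) y\<bar> < e" if "0 < e" for e
  proof -
    obtain d where d: "0 < d" "\<And>p q. p \<in> ?K \<Longrightarrow> q \<in> ?K \<Longrightarrow> dist q p < d \<Longrightarrow> dist (\<phi> q) (\<phi> p) < e"
      using compact_uniformly_continuous[OF cont K] \<open>0 < e\<close> unfolding uniformly_continuous_on_def by metis
    obtain V where V: "V \<in> entourages X" "\<And>x y. (x, y) \<in> V \<Longrightarrow> \<bar>f x - f y\<bar> < d / 2"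
      using UCB_entourage[OF f, of "d / 2"] d(1) by auto
    obtain W where W: "W \<in> entourages X" "\<And>x y. (x, y) \<in> W \<Longrightarrow> \<bar>g x - g y\<bar> < d / 2"
      using UCB_entourage[OF g, of "d / 2"] d(1) by auto
    obtain Z where Z: "Z \<in> entourages X" "Z \<subseteq> V \<inter> W" using entourage_Int[OF V(1) W(1)] by blast
    show ?thesis
    proof (intro bexI[OF _ Z(1)] ballI, clarify)
      fix x y assume xy: "(x, y) \<in> Z"
      then have p: "x \<in> points X" "y \<in> points X" using entourage_subset[OF Z(1)] by auto
      have "dist (f x, g x) (f y, g y) \<le> \<bar>f x - f y\<bar> + \<bar>g x - g y\<bar>"
        using sqrt_sum_squares_le_sum_abs[of "f x - f y" "g x - g y"]
        by (simp add: dist_Pair_Pair dist_real_def)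
      also have "\<dots> < d" using V(2)[of x y] W(2)[of x y] subsetD[OF Z(2) xy] by simp
      finally show "\<bar>(\<lambda>x\<in>points X. \<phi> (f x, g x)) x - (\<lambda>x\<in>points X. \<phi> (f x, g x)) y\<bar> < e"
        using d(2)[OF mem[OF p(2)] mem[OF p(1)]] p by (simp add: dist_real_def)
    qed
  qed
  with bdd show ?thesis by (simp add: UCB_def)
qed

lemma UCB_const: "(\<lambda>x\<in>points X. c) \<in> UCB X"
proof -
  obtain V where V: "V \<in> entourages X" using entourage_ex by blast
  have "\<bar>(\<lambda>x\<in>points X. c) x - (\<lambda>x\<in>points X. c) y\<bar> < e" if "0 < e" "(x, y) \<in> V" for e x y
    using subsetD[OF entourage_subset[OF V] that(2)] that(1) by simp
  then have "\<forall>e>0. \<exists>V\<in>entourages X. \<forall>(x, y)\<in>V. \<bar>(\<lambda>x\<in>points X. c) x - (\<lambda>x\<in>points X. c) y\<bar> < e"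
    using V by (intro allI impI bexI[of _ V]) blast+
  moreover have "bounded ((\<lambda>x\<in>points X. c) ` points X)"
    by (rule bounded_subset[of "{c}"]) auto
  ultimately show ?thesis by (simp add: UCB_def)
qed

lemma UCB_comp:
  fixes \<phi> :: "real \<Rightarrow> real"
  assumes "f \<in> UCB X" "continuous_on UNIV \<phi>"
  shows "(\<lambda>x\<in>points X. \<phi> (f x)) \<in> UCB X"
  using UCB_comp2[OF assms(1,1) continuous_on_compose2[OF assms(2) continuous_on_fst[OF continuous_on_id]]]
  by simp

lemma UCB_add: "f \<in> UCB X \<Longrightarrow> g \<in> UCB X \<Longrightarrow> (\<lambda>x\<in>points X. f x + g x) \<in> UCB X"
  using UCB_comp2[of f g "\<lambda>p. fst p + snd p"]
  by (simp add: continuous_on_add continuous_on_fst continuous_on_snd)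

lemma UCB_mult: "f \<in> UCB X \<Longrightarrow> g \<in> UCB X \<Longrightarrow> (\<lambda>x\<in>points X. f x * g x) \<in> UCB X"
  using UCB_comp2[of f g "\<lambda>p. fst p * snd p"]
  by (simp add: continuous_on_mult continuous_on_fst continuous_on_snd)

lemma UCB_diff: "f \<in> UCB X \<Longrightarrow> g \<in> UCB X \<Longrightarrow> (\<lambda>x\<in>points X. f x - g x) \<in> UCB X"
  using UCB_comp2[of f g "\<lambda>p. fst p - snd p"]
  by (simp add: continuous_on_diff continuous_on_fst continuous_on_snd)

lemma UCB_scale: "f \<in> UCB X \<Longrightarrow> (\<lambda>x\<in>points X. c * f x) \<in> UCB X"
  by (intro UCB_comp continuous_intros)

lemma UCB_abs: "f \<in> UCB X \<Longrightarrow> (\<lambda>x\<in>points X. \<bar>f x\<bar>) \<in> UCB X"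
  by (intro UCB_comp continuous_intros)

lemma UCB_sqrt: "f \<in> UCB X \<Longrightarrow> (\<lambda>x\<in>points X. sqrt (f x)) \<in> UCB X"
  by (intro UCB_comp continuous_intros)

lemma UCB_eqI: "f \<in> UCB X \<Longrightarrow> (\<And>x. x \<in> points X \<Longrightarrow> f x = g x) \<Longrightarrow> (\<lambda>x\<in>points X. g x) = f"
  by (auto simp: UCB_def extensional_def fun_eq_iff)

end

text \<open>Elements of \<open>samuel X\<close> are only required to be ring homomorphisms, so
  real-linearity has to come from order. Additivity fixes the integers and positivity gives
  monotonicity; n \<phi>(c) is therefore caught between the same two consecutive integers as n c,
  and the error of \<phi>(c) is at most 1 / n for every n.\<close>

lemma positive_additive_eq_id:
  fixes \<phi> :: "real \<Rightarrow> real"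
  assumes add: "\<And>a b. \<phi> (a + b) = \<phi> a + \<phi> b" and nonneg: "\<And>a. 0 \<le> a \<Longrightarrow> 0 \<le> \<phi> a"
    and one: "\<phi> 1 = 1"
  shows "\<phi> c = c"
proof -
  have zero: "\<phi> 0 = 0" using add[of 0 0] by simp
  have minus: "\<phi> (- a) = - \<phi> a" for a using add[of a "- a"] zero by simp
  have mono: "\<phi> a \<le> \<phi> b" if "a \<le> b" for a b
    using nonneg[of "b - a"] add[of b "- a"] minus[of a] that by simp
  have nat: "\<phi> (real n * a) = real n * \<phi> a" for n a
    by (induction n) (simp_all add: zero add distrib_right)
  have int: "\<phi> (of_int k) = of_int k" for k
    using nat[of "nat k" 1] nat[of "nat (- k)" 1] minus[of "of_int k"]
    by (cases "0 \<le> k") (auto simp: one)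
  have "real n * \<bar>\<phi> c - c\<bar> \<le> 1" for n
  proof -
    let ?k = "\<lfloor>real n * c\<rfloor>"
    have "of_int ?k \<le> real n * \<phi> c" "real n * \<phi> c \<le> of_int (?k + 1)"
      using mono[of "of_int ?k" "real n * c"] mono[of "real n * c" "of_int (?k + 1)"]
      unfolding int nat by linarith+
    then have "\<bar>real n * \<phi> c - real n * c\<bar> \<le> 1" by linarith
    then show ?thesis by (simp flip: right_diff_distrib add: abs_mult)
  qed
  then have "\<bar>\<phi> c - c\<bar> \<le> 0"
    by (metis mult.commute ex_less_of_nat_mult not_le)
  then show ?thesis by simp
qed

context filtered_uspace
begin

lemma samuelD:
  assumes "\<xi> \<in> samuel X"
  shows "\<xi> \<in> extensional (UCB X)"
    and "f \<in> UCB X \<Longrightarrow> g \<in> UCB X \<Longrightarrow> \<xi> (\<lambda>x\<in>points X. f x + g x) = \<xi> f + \<xi> g"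
    and "f \<in> UCB X \<Longrightarrow> g \<in> UCB X \<Longrightarrow> \<xi> (\<lambda>x\<in>points X. f x * g x) = \<xi> f * \<xi> g"
    and "\<xi> (\<lambda>x\<in>points X. 1) = 1"
  using assms by (auto simp: samuel_def)

text \<open>Positivity is automatic for ring homomorphisms because nonnegative elements are squares.\<close>

lemma samuel_nonneg:
  assumes \<xi>: "\<xi> \<in> samuel X" and f: "f \<in> UCB X" "\<And>x. x \<in> points X \<Longrightarrow> 0 \<le> f x"
  shows "0 \<le> \<xi> f"
proof -
  let ?g = "\<lambda>x\<in>points X. sqrt (f x)"
  have "f = (\<lambda>x\<in>points X. ?g x * ?g x)"
    using f by (intro UCB_eqI[symmetric]) auto
  then have "\<xi> f = \<xi> ?g * \<xi> ?g"
    using samuelD(3)[OF \<xi>, of ?g ?g] UCB_sqrt[OF f(1)] by simp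
  then show ?thesis by simp
qed

text \<open>On constants, \<xi> is an additive, positive, unital map of the real line to itself,
  hence the identity. Multiplicativity then extends this to scalar multiples of arbitrary
  functions.\<close>

lemma samuel_const:
  assumes \<xi>: "\<xi> \<in> samuel X"
  shows "\<xi> (\<lambda>x\<in>points X. c) = c"
proof (rule positive_additive_eq_id)
  fix a b :: real
  have "(\<lambda>x\<in>points X. (\<lambda>x\<in>points X. a) x + (\<lambda>x\<in>points X. b) x) = (\<lambda>x\<in>points X. a + b)"
    by auto
  then show "\<xi> (\<lambda>x\<in>points X. a + b) = \<xi> (\<lambda>x\<in>points X. a) + \<xi> (\<lambda>x\<in>points X. b)"
    using samuelD(2)[OF \<xi> UCB_const UCB_const, of a b] by simp
  show "0 \<le> a \<Longrightarrow> 0 \<le> \<xi> (\<lambda>x\<in>points X. a)"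
    by (rule samuel_nonneg[OF \<xi> UCB_const]) simp
qed (rule samuelD(4)[OF \<xi>])

lemma samuel_scale:
  assumes \<xi>: "\<xi> \<in> samuel X" and f: "f \<in> UCB X"
  shows "\<xi> (\<lambda>x\<in>points X. c * f x) = c * \<xi> f"
proof -
  have "(\<lambda>x\<in>points X. (\<lambda>x\<in>points X. c) x * f x) = (\<lambda>x\<in>points X. c * f x)" by auto
  then show ?thesis
    using samuelD(3)[OF \<xi> UCB_const f, of c] samuel_const[OF \<xi>, of c] by simp
qed

lemma samuel_diff:
  assumes \<xi>: "\<xi> \<in> samuel X" and f: "f \<in> UCB X" and g: "g \<in> UCB X"
  shows "\<xi> (\<lambda>x\<in>points X. f x - g x) = \<xi> f - \<xi> g"
proof -
  have "(\<lambda>x\<in>points X. (\<lambda>x\<in>points X. f x - g x) x + g x) = f"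
    by (rule UCB_eqI[OF f]) simp
  then show ?thesis using samuelD(2)[OF \<xi> UCB_diff[OF f g] g] by simp
qed

text \<open>Both sides are nonnegative with the same square. This identity makes the functions
  \<open>bar f\<close> closed under absolute value.\<close>

lemma samuel_abs:
  assumes \<xi>: "\<xi> \<in> samuel X" and f: "f \<in> UCB X"
  shows "\<xi> (\<lambda>x\<in>points X. \<bar>f x\<bar>) = \<bar>\<xi> f\<bar>"
proof -
  let ?g = "\<lambda>x\<in>points X. \<bar>f x\<bar>"
  have "(\<lambda>x\<in>points X. ?g x * ?g x) = (\<lambda>x\<in>points X. f x * f x)" by auto
  then have "\<xi> ?g * \<xi> ?g = \<xi> f * \<xi> f"
    using samuelD(3)[OF \<xi> f f] samuelD(3)[OF \<xi> UCB_abs[OF f] UCB_abs[OF f]] by simp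
  moreover have "0 \<le> \<xi> ?g" by (rule samuel_nonneg[OF \<xi> UCB_abs[OF f]]) simp
  ultimately show ?thesis
    by (metis real_sqrt_abs2 abs_of_nonneg)
qed

lemma samuel_le:
  assumes \<xi>: "\<xi> \<in> samuel X" and f: "f \<in> UCB X" and B: "\<And>x. x \<in> points X \<Longrightarrow> \<bar>f x\<bar> \<le> B"
  shows "\<bar>\<xi> f\<bar> \<le> B"
proof -
  have "0 \<le> \<xi> (\<lambda>x\<in>points X. (\<lambda>x\<in>points X. B) x - (\<lambda>x\<in>points X. \<bar>f x\<bar>) x)"
    using B by (intro samuel_nonneg[OF \<xi>] UCB_diff UCB_const UCB_abs f) auto
  then show ?thesis
    unfolding samuel_diff[OF \<xi> UCB_const UCB_abs[OF f]] samuel_const[OF \<xi>] samuel_abs[OF \<xi> f] by simp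
qed

lemma eval_in_samuel:
  assumes "x \<in> points X"
  shows "(\<lambda>f\<in>UCB X. f x) \<in> samuel X"
  using assms UCB_const[of 1] by (auto simp: samuel_def UCB_add UCB_mult)

section \<open>Compactness of S(X) and its lattice of functions\<close>

lemma topspace_samuel_top: "topspace (samuel_top X) = samuel X"
  by (auto simp: samuel_top_def samuel_def PiE_def)

lemma continuous_map_bar:
  "f \<in> UCB X \<Longrightarrow> continuous_map (samuel_top X) euclideanreal (bar f)"
  unfolding samuel_top_def bar_def[abs_def]
  by (intro continuous_map_from_subtopology continuous_map_product_projection)

text \<open>The defining equations of \<open>samuel X\<close> are closed conditions in the product
  topology, and \<xi>(f) is bounded by any bound of |f|; so S(X) is closed in a product of compact
  intervals and Tychonoff's theorem applies.\<close>

lemma compact_space_samuel_top: "compact_space (samuel_top X)"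
proof -
  let ?P = "product_topology (\<lambda>_. euclideanreal) (UCB X)"
  have proj: "continuous_map ?P euclideanreal (\<lambda>\<xi>. \<xi> f)" if "f \<in> UCB X" for f
    using continuous_map_product_projection[OF that, of "\<lambda>_. euclideanreal"] .
  define \<A> where "\<A> = (\<lambda>(f, g). {\<xi> \<in> topspace ?P. \<xi> (\<lambda>x\<in>points X. f x + g x) = \<xi> f + \<xi> g}) ` (UCB X \<times> UCB X)"
  define \<M> where "\<M> = (\<lambda>(f, g). {\<xi> \<in> topspace ?P. \<xi> (\<lambda>x\<in>points X. f x * g x) = \<xi> f * \<xi> g}) ` (UCB X \<times> UCB X)"
  define U where "U = {\<xi> \<in> topspace ?P. \<xi> (\<lambda>x\<in>points X. 1) = 1}"
  note eq = closedin_continuous_maps_eq[OF Hausdorff_space_euclidean]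
  have "closedin ?P U"
    unfolding U_def by (intro eq proj UCB_const) simp
  moreover have "closedin ?P {\<xi> \<in> topspace ?P. \<xi> (\<lambda>x\<in>points X. f x + g x) = \<xi> f + \<xi> g}"
    "closedin ?P {\<xi> \<in> topspace ?P. \<xi> (\<lambda>x\<in>points X. f x * g x) = \<xi> f * \<xi> g}"
    if "f \<in> UCB X" "g \<in> UCB X" for f g
    by (intro eq proj UCB_add UCB_mult continuous_map_add continuous_map_real_mult that)+
  \<comment> \<open>Inserting \<open>U\<close> makes the family visibly nonempty, so its
    intersection is a closed subset of the product.\<close>
  ultimately have "closedin ?P (\<Inter> (insert U (\<A> \<union> \<M>)))"
    unfolding \<A>_def \<M>_def by (intro closedin_Inter) (auto simp del: topspace_product_topology)
  moreover have "\<Inter> (insert U (\<A> \<union> \<M>)) = samuel X"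
    unfolding U_def \<A>_def \<M>_def by (auto simp: samuel_def PiE_def)
  ultimately have closed: "closedin ?P (samuel X)" by simp
  define B where "B f = (SOME b. \<forall>x\<in>points X. \<bar>f x\<bar> \<le> b)" for f :: "'a \<Rightarrow> real"
  have ex: "\<exists>b. \<forall>x\<in>points X. \<bar>f x\<bar> \<le> b" if "f \<in> UCB X" for f
    by (rule UCB_bounded[OF that]) blast
  have B: "\<forall>x\<in>points X. \<bar>f x\<bar> \<le> B f" if "f \<in> UCB X" for f
    unfolding B_def by (rule someI_ex[OF ex[OF that]])
  have "samuel X \<subseteq> PiE (UCB X) (\<lambda>f. {- B f..B f})"
  proof (intro subsetI PiE_I)
    fix \<xi> f assume \<xi>: "\<xi> \<in> samuel X"
    show "\<xi> f \<in> {- B f..B f}" if "f \<in> UCB X"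
      using samuel_le[OF \<xi> that bspec[OF B[OF that]]] by (simp add: abs_le_iff)
    show "\<xi> f = undefined" if "f \<notin> UCB X"
      using samuelD(1)[OF \<xi>] that by (simp add: extensional_def)
  qed
  moreover have "compactin ?P (PiE (UCB X) (\<lambda>f. {- B f..B f}))"
    by (simp add: compactin_PiE)
  ultimately have "compactin ?P (samuel X)"
    by (intro closed_compactin[OF _ _ closed])
  then show ?thesis
    unfolding samuel_top_def by (rule compact_space_subtopology)
qed

text \<open>Only the values on \<open>samuel X\<close> are prescribed. The functions
  \<open>bar f\<close> themselves are not closed under the operations on the whole type: off
  \<open>samuel X\<close>, the function \<open>bar\<close> of the constant 1 need not be 1.\<close>

definition ucb_functions :: "((('a \<Rightarrow> real) \<Rightarrow> real) \<Rightarrow> real) set" where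
  "ucb_functions = {F. \<exists>f\<in>UCB X. \<forall>\<xi>\<in>samuel X. F \<xi> = \<xi> f}"

text \<open>Evaluating \<open>F\<close> at the point evaluations recovers the function on X that
  represents it. Being an explicit formula, it commutes with sums and multiples for arbitrary
  \<open>F\<close>.\<close>

definition on_points :: "((('a \<Rightarrow> real) \<Rightarrow> real) \<Rightarrow> real) \<Rightarrow> 'a \<Rightarrow> real" where
  "on_points F = (\<lambda>x\<in>points X. F (\<lambda>f\<in>UCB X. f x))"

lemma bar_in_ucb_functions: "f \<in> UCB X \<Longrightarrow> bar f \<in> ucb_functions"
  by (auto simp: ucb_functions_def bar_def)

lemma on_points_eq:
  assumes "f \<in> UCB X" "\<And>\<xi>. \<xi> \<in> samuel X \<Longrightarrow> F \<xi> = \<xi> f"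
  shows "on_points F = f"
  unfolding on_points_def using assms by (intro UCB_eqI) (auto simp: eval_in_samuel)

lemma ucb_functionsE:
  assumes "F \<in> ucb_functions"
  shows "on_points F \<in> UCB X" "\<And>\<xi>. \<xi> \<in> samuel X \<Longrightarrow> F \<xi> = \<xi> (on_points F)"
proof -
  obtain f where f: "f \<in> UCB X" "\<And>\<xi>. \<xi> \<in> samuel X \<Longrightarrow> F \<xi> = \<xi> f"
    using assms by (auto simp: ucb_functions_def)
  with on_points_eq[of f F] show "on_points F \<in> UCB X" "\<And>\<xi>. \<xi> \<in> samuel X \<Longrightarrow> F \<xi> = \<xi> (on_points F)"
    by simp_all
qed

lemma on_points_bar: "f \<in> UCB X \<Longrightarrow> on_points (bar f) = f"
  by (rule on_points_eq) (simp_all add: bar_def)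

lemma ucb_functionsI: "f \<in> UCB X \<Longrightarrow> (\<And>\<xi>. \<xi> \<in> samuel X \<Longrightarrow> F \<xi> = \<xi> f) \<Longrightarrow> F \<in> ucb_functions"
  by (auto simp: ucb_functions_def)

sublocale separating_lattice "samuel_top X" ucb_functions
proof
  show "compact_space (samuel_top X)" by (rule compact_space_samuel_top)
  show "continuous_map (samuel_top X) euclideanreal F" if "F \<in> ucb_functions" for F
    using continuous_map_bar[OF ucb_functionsE(1)[OF that]]
    by (rule continuous_map_eq) (simp add: topspace_samuel_top ucb_functionsE(2)[OF that] bar_def)
  show "(\<lambda>\<xi>. F \<xi> + G \<xi>) \<in> ucb_functions" if "F \<in> ucb_functions" "G \<in> ucb_functions" for F G
    using that[THEN ucb_functionsE(1)]
    by (intro ucb_functionsI[of "\<lambda>x\<in>points X. on_points F x + on_points G x"])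
      (simp_all add: UCB_add samuelD(2) that[THEN ucb_functionsE(2)])
  show "(\<lambda>\<xi>. c * F \<xi>) \<in> ucb_functions" if "F \<in> ucb_functions" for F c
    using that[THEN ucb_functionsE(1)]
    by (intro ucb_functionsI[of "\<lambda>x\<in>points X. c * on_points F x"])
      (simp_all add: UCB_scale samuel_scale that[THEN ucb_functionsE(2)])
  show "(\<lambda>\<xi>. \<bar>F \<xi>\<bar>) \<in> ucb_functions" if "F \<in> ucb_functions" for F
    using that[THEN ucb_functionsE(1)]
    by (intro ucb_functionsI[of "\<lambda>x\<in>points X. \<bar>on_points F x\<bar>"])
      (simp_all add: UCB_abs samuel_abs that[THEN ucb_functionsE(2)])
  show "(\<lambda>\<xi>. 1) \<in> ucb_functions"
    by (intro ucb_functionsI[OF UCB_const[of 1]]) (simp add: samuel_const)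
  fix \<xi> \<eta> assume "\<xi> \<in> topspace (samuel_top X)" "\<eta> \<in> topspace (samuel_top X)" "\<xi> \<noteq> \<eta>"
  then obtain f where "f \<in> UCB X" "\<xi> f \<noteq> \<eta> f"
    unfolding topspace_samuel_top using extensionalityI[of \<xi> "UCB X" \<eta>] samuelD(1) by blast
  then show "\<exists>F\<in>ucb_functions. F \<xi> \<noteq> F \<eta>"
    using bar_in_ucb_functions[of f] by (auto simp: bar_def intro!: bexI[of _ "bar f"])
qed

section \<open>The representing measure of a mean\<close>

lemma lattice_mean_on_points:
  assumes \<mu>: "\<mu> \<in> means X"
  shows "lattice_mean (samuel_top X) ucb_functions (\<lambda>F. \<mu> (on_points F))"
proof
  have add: "on_points (\<lambda>\<xi>. F \<xi> + G \<xi>) = (\<lambda>x\<in>points X. on_points F x + on_points G x)"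
    and scale: "on_points (\<lambda>\<xi>. c * F \<xi>) = (\<lambda>x\<in>points X. c * on_points F x)" for F G c
    by (auto simp: on_points_def)
  show "\<mu> (on_points (\<lambda>\<xi>. F \<xi> + G \<xi>)) = \<mu> (on_points F) + \<mu> (on_points G)"
    if "F \<in> ucb_functions" "G \<in> ucb_functions" for F G
    unfolding add using \<mu> that[THEN ucb_functionsE(1)] by (simp add: means_def)
  show "\<mu> (on_points (\<lambda>\<xi>. c * F \<xi>)) = c * \<mu> (on_points F)" if "F \<in> ucb_functions" for F c
    unfolding scale using \<mu> that[THEN ucb_functionsE(1)] by (simp add: means_def)
  show "0 \<le> \<mu> (on_points F)"
    if "F \<in> ucb_functions" "\<And>\<xi>. \<xi> \<in> topspace (samuel_top X) \<Longrightarrow> 0 \<le> F \<xi>" for F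
  proof -
    have "\<forall>x\<in>points X. 0 \<le> on_points F x"
      using that(2) by (simp add: on_points_def topspace_samuel_top eval_in_samuel)
    then show ?thesis using \<mu> ucb_functionsE(1)[OF that(1)] by (simp add: means_def)
  qed
  show "\<mu> (on_points (\<lambda>\<xi>. 1)) = 1"
    using \<mu> by (simp add: means_def on_points_def)
qed

text \<open>The description in \<open>hat\<close> is shown to denote. For uniqueness, the prescribed
  integrals of the functions \<open>bar f\<close> extend to all of \<open>ucb_functions\<close>,
  since each member agrees with some \<open>bar f\<close> on the underlying space.\<close>

lemma hat_representing:
  assumes \<mu>: "\<mu> \<in> means X"
  shows "regular_borel_prob (samuel_top X) (hat X \<mu>) \<and> (\<forall>f\<in>UCB X. integral\<^sup>L (hat X \<mu>) (bar f) = \<mu> f)"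
  unfolding hat_def
proof (rule theI')
  interpret M: lattice_mean "samuel_top X" ucb_functions "\<lambda>F. \<mu> (on_points F)"
    by (rule lattice_mean_on_points[OF \<mu>])
  show "\<exists>!m. regular_borel_prob (samuel_top X) m \<and> (\<forall>f\<in>UCB X. integral\<^sup>L m (bar f) = \<mu> f)"
  proof (intro ex1I[of _ M.riesz] conjI ballI M.regular_riesz)
    show "integral\<^sup>L M.riesz (bar f) = \<mu> f" if "f \<in> UCB X" for f
      using M.integral_riesz[OF bar_in_ucb_functions[OF that]] by (simp add: on_points_bar that)
  next
    fix m assume m: "regular_borel_prob (samuel_top X) m \<and> (\<forall>f\<in>UCB X. integral\<^sup>L m (bar f) = \<mu> f)"
    show "m = M.riesz"
    proof (rule M.riesz_unique)
      fix F assume F: "F \<in> ucb_functions"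
      have "integral\<^sup>L m F = integral\<^sup>L m (bar (on_points F))"
        using m ucb_functionsE(2)[OF F]
        by (intro Bochner_Integration.integral_cong)
          (auto simp: bar_def regular_borel_probD(3) topspace_samuel_top)
      then show "integral\<^sup>L m F = \<mu> (on_points F)"
        using m ucb_functionsE(1)[OF F] by simp
    qed (use m in blast)
  qed
qed

end

section \<open>Elementary properties of means\<close>

lemma (in filtered_uspace) means_diff:
  assumes \<mu>: "\<mu> \<in> means X" and f: "f \<in> UCB X" and g: "g \<in> UCB X"
  shows "\<mu> (\<lambda>x\<in>points X. f x - g x) = \<mu> f - \<mu> g"
proof -
  have "(\<lambda>x\<in>points X. (\<lambda>x\<in>points X. f x - g x) x + g x) = f"
    by (rule UCB_eqI[OF f]) simp
  moreover have "\<mu> (\<lambda>x\<in>points X. (\<lambda>x\<in>points X. f x - g x) x + g x) =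
      \<mu> (\<lambda>x\<in>points X. f x - g x) + \<mu> g"
    using \<mu> UCB_diff[OF f g] g unfolding means_def by blast
  ultimately show ?thesis by simp
qed

lemma (in filtered_uspace) means_const:
  assumes "\<mu> \<in> means X"
  shows "\<mu> (\<lambda>x\<in>points X. c) = c"
proof -
  have "\<mu> (\<lambda>x\<in>points X. c * (\<lambda>x\<in>points X. 1) x) = c * \<mu> (\<lambda>x\<in>points X. 1)"
    using assms UCB_const[of 1] unfolding means_def by blast
  moreover have "(\<lambda>x\<in>points X. c * (\<lambda>x\<in>points X. 1) x) = (\<lambda>x\<in>points X. c)" by auto
  moreover have "\<mu> (\<lambda>x\<in>points X. 1) = 1" using assms by (simp add: means_def)
  ultimately show ?thesis by simp
qed

lemma (in filtered_uspace) means_abs_le: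
  assumes \<mu>: "\<mu> \<in> means X" and f: "f \<in> UCB X" and le: "\<And>x. x \<in> points X \<Longrightarrow> \<bar>f x\<bar> \<le> c"
  shows "\<bar>\<mu> f\<bar> \<le> c"
proof -
  have pos: "0 \<le> \<mu> h" if "h \<in> UCB X" "\<And>x. x \<in> points X \<Longrightarrow> 0 \<le> h x" for h
    using \<mu> that unfolding means_def by blast
  have "0 \<le> \<mu> (\<lambda>x\<in>points X. (\<lambda>x\<in>points X. c) x - f x)"
    using le by (intro pos UCB_diff UCB_const f) (fastforce simp: abs_le_iff)
  moreover have "0 \<le> \<mu> (\<lambda>x\<in>points X. f x - (\<lambda>x\<in>points X. - c) x)"
    using le by (intro pos UCB_diff UCB_const f) (fastforce simp: abs_le_iff)
  ultimately show ?thesis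
    by (simp add: means_diff[OF \<mu>] means_const[OF \<mu>] UCB_const f abs_le_iff del: restrict_apply)
qed

section \<open>Functoriality of the Samuel compactification\<close>

lemma samuel_map_apply:
  "\<xi> \<in> samuel X \<Longrightarrow> k \<in> UCB Y \<Longrightarrow> samuel_map X Y \<phi> \<xi> k = \<xi> (\<lambda>x\<in>points X. k (\<phi> x))"
  by (simp add: samuel_map_def)

lemma samuel_map_in_samuel:
  assumes X: "filtered_uspace X" and Y: "filtered_uspace Y"
    and \<phi>: "\<And>x. x \<in> points X \<Longrightarrow> \<phi> x \<in> points Y"
    and pull: "\<And>k. k \<in> UCB Y \<Longrightarrow> (\<lambda>x\<in>points X. k (\<phi> x)) \<in> UCB X"
    and \<xi>: "\<xi> \<in> samuel X"
  shows "samuel_map X Y \<phi> \<xi> \<in> samuel Y"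
proof -
  interpret X: filtered_uspace X by fact
  interpret Y: filtered_uspace Y by fact
  note app = samuel_map_apply[OF \<xi>, where \<phi> = \<phi>]
  let ?p = "\<lambda>k. \<lambda>x\<in>points X. k (\<phi> x)"
  show ?thesis
    unfolding samuel_def
  proof (intro CollectI conjI ballI)
    show "samuel_map X Y \<phi> \<xi> \<in> extensional (UCB Y)"
      using \<xi> by (simp add: samuel_map_def)
    have "?p (\<lambda>y\<in>points Y. 1) = (\<lambda>x\<in>points X. 1 :: real)" using \<phi> by auto
    then show "samuel_map X Y \<phi> \<xi> (\<lambda>y\<in>points Y. 1) = 1"
      by (simp only: app[OF Y.UCB_const] X.samuelD(4)[OF \<xi>])
    fix k l assume k: "k \<in> UCB Y" and l: "l \<in> UCB Y"
    have "?p (\<lambda>y\<in>points Y. k y + l y) = (\<lambda>x\<in>points X. ?p k x + ?p l x)" using \<phi> by auto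
    then show "samuel_map X Y \<phi> \<xi> (\<lambda>y\<in>points Y. k y + l y) = samuel_map X Y \<phi> \<xi> k + samuel_map X Y \<phi> \<xi> l"
      by (simp only: app[OF Y.UCB_add[OF k l]] app[OF k] app[OF l] X.samuelD(2)[OF \<xi> pull[OF k] pull[OF l]])
    have "?p (\<lambda>y\<in>points Y. k y * l y) = (\<lambda>x\<in>points X. ?p k x * ?p l x)" using \<phi> by auto
    then show "samuel_map X Y \<phi> \<xi> (\<lambda>y\<in>points Y. k y * l y) = samuel_map X Y \<phi> \<xi> k * samuel_map X Y \<phi> \<xi> l"
      by (simp only: app[OF Y.UCB_mult[OF k l]] app[OF k] app[OF l] X.samuelD(3)[OF \<xi> pull[OF k] pull[OF l]])
  qed
qed

text \<open>Continuity into a product is tested on coordinates, and the coordinate at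
  \<open>k\<close> of S(\<phi>) is \<open>bar\<close> of the pullback of \<open>k\<close>. Uniform
  continuity of \<phi> enters in the form of \<open>pull\<close>.\<close>

lemma continuous_map_samuel_map:
  assumes X: "filtered_uspace X" and Y: "filtered_uspace Y"
    and \<phi>: "\<And>x. x \<in> points X \<Longrightarrow> \<phi> x \<in> points Y"
    and pull: "\<And>k. k \<in> UCB Y \<Longrightarrow> (\<lambda>x\<in>points X. k (\<phi> x)) \<in> UCB X"
  shows "continuous_map (samuel_top X) (samuel_top Y) (samuel_map X Y \<phi>)"
proof -
  interpret X: filtered_uspace X by fact
  interpret Y: filtered_uspace Y by fact
  have mem: "samuel_map X Y \<phi> \<xi> \<in> samuel Y" if "\<xi> \<in> samuel X" for \<xi>
    using samuel_map_in_samuel[where \<phi> = \<phi>, OF X Y] \<phi> pull that by blast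
  have "continuous_map (samuel_top X) euclideanreal (\<lambda>\<xi>. samuel_map X Y \<phi> \<xi> k)" if k: "k \<in> UCB Y" for k
    by (rule continuous_map_eq[OF X.continuous_map_bar[OF pull[OF k]]])
      (simp add: X.topspace_samuel_top bar_def samuel_map_apply[OF _ k])
  then show ?thesis
    unfolding samuel_top_def[of Y] continuous_map_in_subtopology continuous_map_componentwise
    using mem Y.samuelD(1) by (auto simp: X.topspace_samuel_top)
qed

text \<open>A set and its complement in the pulled back \<open>\<sigma>\<close>-algebra are exhausted by compact sets;
  their images are disjoint and compact, so a function of the lattice separates them.\<close>

lemma integral_indicator_vimage_eq_0:
  assumes m: "regular_borel_prob T m" and S: "separating_lattice S A"
    and s: "continuous_map T S s"
    and d: "integrable m d" "\<And>x. x \<in> topspace T \<Longrightarrow> \<bar>d x\<bar> \<le> c"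
    and zero: "\<And>F. F \<in> A \<Longrightarrow> (\<integral>x. F (s x) * d x \<partial>m) = 0"
    and B: "B \<in> sets (borel_of_top S)"
  shows "(\<integral>x. indicator (s -` B \<inter> topspace T) x * d x \<partial>m) = 0"
proof -
  interpret S: separating_lattice S A by fact
  note D = regular_borel_probD[OF m]
  interpret prob_space m by (rule D(2))
  let ?P = "s -` B \<inter> topspace T" and ?Q = "topspace T - (s -` B \<inter> topspace T)"
  have s_meas: "s \<in> measurable m (borel_of_top S)"
    using continuous_map_measurable_borel_of_top[OF s] measurable_cong_sets[OF D(1) refl] by blast
  have P: "?P \<in> sets m"
    using measurable_sets[OF s_meas B] by (simp add: D(3))
  have Q: "?Q \<in> sets m" using sets.compl_sets[OF P] by (simp add: D(3))
  \<comment> \<open>Inner regularity in additive form. If the measure is below \<open>e\<close> the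
    empty set serves; otherwise the difference is nonnegative and survives the conversion to
    \<open>ennreal\<close>.\<close>
  have inner: "\<exists>K. K \<subseteq> E \<and> compactin T K \<and> K \<in> sets m \<and> measure m E < measure m K + e"
    if E: "E \<in> sets m" and e: "0 < e" for E e
  proof (cases "measure m E < e")
    case True
    then show ?thesis by (intro exI[of _ "{}"]) auto
  next
    case False
    then have "ennreal (measure m E - e) < emeasure m E"
      using e by (simp add: emeasure_eq_measure ennreal_less_iff)
    then obtain K where "K \<subseteq> E" "compactin T K" "K \<in> sets m" "ennreal (measure m E - e) < emeasure m K"
      unfolding D(5)[OF E] less_SUP_iff by blast
    then show ?thesis using False
      by (intro exI[of _ K]) (auto simp: emeasure_eq_measure ennreal_less_iff)
  qed
  have c: "0 \<le> c"
    using d(2) not_empty D(3) by (metis abs_ge_zero all_not_in_conv order_trans)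
  have "\<bar>\<integral>x. indicator ?P x * d x \<partial>m\<bar> \<le> c * (2 * e)" if e: "0 < e" for e
  proof -
    obtain K where K: "K \<subseteq> ?P" "compactin T K" "K \<in> sets m" "measure m ?P < measure m K + e"
      using inner[OF P e] by blast
    obtain L where L: "L \<subseteq> ?Q" "compactin T L" "L \<in> sets m" "measure m ?Q < measure m L + e"
      using inner[OF Q e] by blast
    \<comment> \<open>Points of \<open>K\<close> are mapped into \<open>B\<close> and points of
      \<open>L\<close> outside it, so the images cannot meet.\<close>
    have "s x \<noteq> s y" if "x \<in> K" "y \<in> L" for x y
      using subsetD[OF K(1) that(1)] subsetD[OF L(1) that(2)] by auto
    then have "s ` K \<inter> s ` L = {}" by auto
    then obtain F where F: "F \<in> A" "\<And>y. 0 \<le> F y" "\<And>y. F y \<le> 1"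
      "\<And>y. y \<in> s ` K \<Longrightarrow> F y = 1" "\<And>y. y \<in> s ` L \<Longrightarrow> F y = 0"
      using S.urysohn[OF image_compactin[OF K(2) s] image_compactin[OF L(2) s]] by metis
    let ?R = "space m - (K \<union> L)"
    have R: "?R \<in> sets m" using K(3) L(3) by auto
    have F_meas: "(\<lambda>x. F (s x)) \<in> borel_measurable m"
      using measurable_compose[OF s_meas continuous_map_borel_measurable[OF S.cont[OF F(1)]]] .
    have int_P: "integrable m (\<lambda>x. indicator ?P x * d x)"
      using integrable_real_mult_indicator[OF P d(1)] by (simp add: mult.commute)
    have int_F: "integrable m (\<lambda>x. F (s x) * d x)"
    proof (rule Bochner_Integration.integrable_bound[OF d(1)])
      show "(\<lambda>x. F (s x) * d x) \<in> borel_measurable m"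
        using F_meas d(1) by simp
    qed (simp add: abs_mult mult_left_le_one_le F(2,3))
    have "(\<integral>x. indicator ?P x * d x \<partial>m) = (\<integral>x. indicator ?P x * d x - F (s x) * d x \<partial>m)"
      using int_P int_F zero[OF F(1)] by simp
    also have "\<bar>\<dots>\<bar> \<le> (\<integral>x. c * indicator ?R x \<partial>m)"
    proof (rule order_trans[OF integral_abs_bound integral_mono])
      show "integrable m (\<lambda>x. \<bar>indicator ?P x * d x - F (s x) * d x\<bar>)"
        using int_P int_F by simp
      show "integrable m (\<lambda>x. c * indicator ?R x)"
        using R by (intro integrable_mult_right integrable_real_indicator) (simp_all add: less_top[symmetric])
      fix x assume x: "x \<in> space m"
      have eq: "indicator ?P x * d x - F (s x) * d x = (indicator ?P x - F (s x)) * d x"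
        by (simp add: left_diff_distrib)
      \<comment> \<open>On \<open>K\<close> both terms are 1 and on \<open>L\<close> both are 0;
        elsewhere both lie in [0, 1]. The exceptional set \<open>?R\<close> has measure at most 2 e,
        one \<open>e\<close> for each compact set.\<close>
      have "\<bar>indicator ?P x - F (s x)\<bar> \<le> indicator ?R x"
        using x K(1) L(1) F(2,3)[of "s x"] F(4)[of "s x"] F(5)[of "s x"] by (auto simp: indicator_def)
      then have "\<bar>indicator ?P x - F (s x)\<bar> * \<bar>d x\<bar> \<le> indicator ?R x * c"
        using d(2) x D(3) by (intro mult_mono) auto
      then show "\<bar>indicator ?P x * d x - F (s x) * d x\<bar> \<le> c * indicator ?R x"
        unfolding eq abs_mult by (simp add: mult.commute)
    qed
    also have "\<dots> = c * measure m ?R"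
      using R by (simp add: Int_absorb1)
    also have "measure m ?R \<le> 2 * e"
    proof -
      have "K \<inter> L = {}" using K(1) L(1) by auto
      then have "measure m (K \<union> L) = measure m K + measure m L"
        using K(3) L(3) by (intro finite_measure_Union)
      moreover have "measure m ?R = 1 - measure m (K \<union> L)"
        using K(3) L(3) by (intro prob_compl) auto
      moreover have "measure m ?Q = 1 - measure m ?P"
        using prob_compl[OF P] by (simp add: D(3))
      ultimately show ?thesis using K(4) L(4) by simp
    qed
    finally show ?thesis using c by (simp add: mult_left_mono)
  qed
  note bound = this
  have "\<bar>\<integral>x. indicator ?P x * d x \<partial>m\<bar> \<le> 0 + e" if e: "0 < e" for e
  proof -
    \<comment> \<open>Dividing by c + 1 rather than by c covers the case c = 0.\<close>
    have "\<bar>\<integral>x. indicator ?P x * d x \<partial>m\<bar> \<le> c * (2 * (e / (2 * (c + 1))))"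
      using c e by (intro bound) simp
    also have "\<dots> \<le> e" using c e by (simp add: field_simps)
    finally show ?thesis by simp
  qed
  then have "\<bar>\<integral>x. indicator ?P x * d x \<partial>m\<bar> \<le> 0" by (rule field_le_epsilon)
  then show ?thesis by simp
qed

section \<open>Topological groups\<close>

lemma nbhds_one_Int:
  assumes "U \<in> nbhds_one G T" "V \<in> nbhds_one G T"
  shows "U \<inter> V \<in> nbhds_one G T"
proof -
  obtain W W' where "openin T W" "\<one>\<^bsub>G\<^esub> \<in> W" "W \<subseteq> U" "openin T W'" "\<one>\<^bsub>G\<^esub> \<in> W'" "W' \<subseteq> V"
    using assms by (auto simp: nbhds_one_def)
  then have "openin T (W \<inter> W')" "\<one>\<^bsub>G\<^esub> \<in> W \<inter> W'" "W \<inter> W' \<subseteq> U \<inter> V" by auto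
  then show ?thesis using assms unfolding nbhds_one_def by blast
qed

lemma carrier_nbhds_one: "topspace T = carrier G \<Longrightarrow> \<one>\<^bsub>G\<^esub> \<in> carrier G \<Longrightarrow> carrier G \<in> nbhds_one G T"
  using openin_topspace[of T] unfolding nbhds_one_def by auto

lemma points_right_uspace: "points (right_uspace G T) = carrier G"
  by (simp add: right_uspace_def)

lemma points_coset_uspace: "points (coset_uspace G T H) = coset_proj G H ` carrier G"
  by (simp add: coset_uspace_def)

lemma RUCB_iff:
  "f \<in> RUCB G T \<longleftrightarrow> f \<in> extensional (carrier G) \<and> bounded (f ` carrier G) \<and>
    (\<forall>e>0. \<exists>U\<in>nbhds_one G T. \<forall>x\<in>carrier G. \<forall>y\<in>carrier G.
      x \<otimes>\<^bsub>G\<^esub> inv\<^bsub>G\<^esub> y \<in> U \<longrightarrow> \<bar>f x - f y\<bar> < e)"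
proof -
  have "(\<exists>V\<in>entourages (right_uspace G T). \<forall>(x, y)\<in>V. \<bar>f x - f y\<bar> < e) \<longleftrightarrow>
    (\<exists>U\<in>nbhds_one G T. \<forall>x\<in>carrier G. \<forall>y\<in>carrier G. x \<otimes>\<^bsub>G\<^esub> inv\<^bsub>G\<^esub> y \<in> U \<longrightarrow> \<bar>f x - f y\<bar> < e)"
    (is "?L \<longleftrightarrow> ?R") for e
  proof
    assume ?L
    then obtain V where V: "V \<in> entourages (right_uspace G T)" "\<And>x y. (x, y) \<in> V \<Longrightarrow> \<bar>f x - f y\<bar> < e"
      by blast
    then obtain U where "U \<in> nbhds_one G T"
      "{(x, y). x \<in> carrier G \<and> y \<in> carrier G \<and> x \<otimes>\<^bsub>G\<^esub> inv\<^bsub>G\<^esub> y \<in> U} \<subseteq> V"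
      by (auto simp: right_uspace_def)
    then show ?R by (intro bexI[of _ U] ballI impI V(2)) auto
  next
    assume ?R
    then obtain U where "U \<in> nbhds_one G T"
      "\<forall>x\<in>carrier G. \<forall>y\<in>carrier G. x \<otimes>\<^bsub>G\<^esub> inv\<^bsub>G\<^esub> y \<in> U \<longrightarrow> \<bar>f x - f y\<bar> < e" by blast
    then show ?L
      by (intro bexI[of _ "{(x, y). x \<in> carrier G \<and> y \<in> carrier G \<and> x \<otimes>\<^bsub>G\<^esub> inv\<^bsub>G\<^esub> y \<in> U}"])
        (auto simp: right_uspace_def)
  qed
  then show ?thesis by (simp add: UCB_def points_right_uspace)
qed

lemma UCB_coset_iff:
  "k \<in> UCB (coset_uspace G T H) \<longleftrightarrow> k \<in> extensional (coset_proj G H ` carrier G) \<and>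
    bounded (k ` coset_proj G H ` carrier G) \<and>
    (\<forall>e>0. \<exists>U\<in>nbhds_one G T. \<forall>x\<in>carrier G. \<forall>y\<in>carrier G.
      x \<otimes>\<^bsub>G\<^esub> inv\<^bsub>G\<^esub> y \<in> U \<longrightarrow> \<bar>k (coset_proj G H x) - k (coset_proj G H y)\<bar> < e)"
proof -
  have "(\<exists>V\<in>entourages (coset_uspace G T H). \<forall>(x, y)\<in>V. \<bar>k x - k y\<bar> < e) \<longleftrightarrow>
    (\<exists>U\<in>nbhds_one G T. \<forall>x\<in>carrier G. \<forall>y\<in>carrier G. x \<otimes>\<^bsub>G\<^esub> inv\<^bsub>G\<^esub> y \<in> U \<longrightarrow>
      \<bar>k (coset_proj G H x) - k (coset_proj G H y)\<bar> < e)"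
    (is "?L \<longleftrightarrow> ?R") for e
  proof
    assume ?L
    then obtain V where V: "V \<in> entourages (coset_uspace G T H)" "\<And>x y. (x, y) \<in> V \<Longrightarrow> \<bar>k x - k y\<bar> < e"
      by blast
    then obtain U where "U \<in> nbhds_one G T" "\<And>x y. x \<in> carrier G \<Longrightarrow> y \<in> carrier G \<Longrightarrow>
      x \<otimes>\<^bsub>G\<^esub> inv\<^bsub>G\<^esub> y \<in> U \<Longrightarrow> (coset_proj G H x, coset_proj G H y) \<in> V"
      by (auto simp: coset_uspace_def)
    then show ?R by (intro bexI[of _ U] ballI impI V(2)) auto
  next
    assume ?R
    then obtain U where "U \<in> nbhds_one G T" "\<forall>x\<in>carrier G. \<forall>y\<in>carrier G. x \<otimes>\<^bsub>G\<^esub> inv\<^bsub>G\<^esub> y \<in> U \<longrightarrow>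
      \<bar>k (coset_proj G H x) - k (coset_proj G H y)\<bar> < e" by blast
    then show ?L
      \<comment> \<open>The largest relation satisfying the estimate is taken as the entourage; the
        neighbourhood \<open>U\<close> shows that it is one.\<close>
      by (intro bexI[of _ "{(C, D). C \<in> coset_proj G H ` carrier G \<and> D \<in> coset_proj G H ` carrier G \<and> \<bar>k C - k D\<bar> < e}"])
        (auto simp: coset_uspace_def)
  qed
  then show ?thesis by (simp add: UCB_def points_coset_uspace)
qed

lemma filtered_right_uspace:
  assumes "topspace T = carrier G" "\<one>\<^bsub>G\<^esub> \<in> carrier G"
  shows "filtered_uspace (right_uspace G T)"
proof
  show "\<exists>V. V \<in> entourages (right_uspace G T)"
    using carrier_nbhds_one[OF assms] by (auto simp: right_uspace_def intro!: exI[of _ "carrier G \<times> carrier G"])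
  fix V assume V: "V \<in> entourages (right_uspace G T)"
  then show "V \<subseteq> points (right_uspace G T) \<times> points (right_uspace G T)"
    by (simp add: right_uspace_def)
  fix W assume W: "W \<in> entourages (right_uspace G T)"
  obtain U U' where "U \<in> nbhds_one G T" "U' \<in> nbhds_one G T"
    "{(x, y). x \<in> carrier G \<and> y \<in> carrier G \<and> x \<otimes>\<^bsub>G\<^esub> inv\<^bsub>G\<^esub> y \<in> U} \<subseteq> V"
    "{(x, y). x \<in> carrier G \<and> y \<in> carrier G \<and> x \<otimes>\<^bsub>G\<^esub> inv\<^bsub>G\<^esub> y \<in> U'} \<subseteq> W"
    using V W by (auto simp: right_uspace_def)
  then have "V \<inter> W \<in> entourages (right_uspace G T)"
    using V nbhds_one_Int[of U G T U'] by (auto simp: right_uspace_def intro!: bexI[of _ "U \<inter> U'"])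
  then show "\<exists>Z\<in>entourages (right_uspace G T). Z \<subseteq> V \<inter> W" by blast
qed

lemma filtered_coset_uspace:
  assumes "topspace T = carrier G" "\<one>\<^bsub>G\<^esub> \<in> carrier G"
  shows "filtered_uspace (coset_uspace G T H)"
proof
  let ?P = "coset_proj G H ` carrier G"
  show "\<exists>V. V \<in> entourages (coset_uspace G T H)"
    using carrier_nbhds_one[OF assms] by (auto simp: coset_uspace_def intro!: exI[of _ "?P \<times> ?P"])
  fix V assume V: "V \<in> entourages (coset_uspace G T H)"
  then show "V \<subseteq> points (coset_uspace G T H) \<times> points (coset_uspace G T H)"
    by (simp add: coset_uspace_def)
  fix W assume W: "W \<in> entourages (coset_uspace G T H)"
  obtain U U' where "U \<in> nbhds_one G T" "U' \<in> nbhds_one G T"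
    "\<forall>x\<in>carrier G. \<forall>y\<in>carrier G. x \<otimes>\<^bsub>G\<^esub> inv\<^bsub>G\<^esub> y \<in> U \<longrightarrow> (coset_proj G H x, coset_proj G H y) \<in> V"
    "\<forall>x\<in>carrier G. \<forall>y\<in>carrier G. x \<otimes>\<^bsub>G\<^esub> inv\<^bsub>G\<^esub> y \<in> U' \<longrightarrow> (coset_proj G H x, coset_proj G H y) \<in> W"
    using V W by (auto simp: coset_uspace_def)
  then have "V \<inter> W \<in> entourages (coset_uspace G T H)"
    using V nbhds_one_Int[of U G T U'] by (auto simp: coset_uspace_def intro!: bexI[of _ "U \<inter> U'"])
  then show "\<exists>Z\<in>entourages (coset_uspace G T H). Z \<subseteq> V \<inter> W" by blast
qed

section \<open>Translation and restriction of right uniformly continuous functions\<close>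

lemma nbhds_one_conj:
  assumes G: "topological_group G T" and g: "g \<in> carrier G" and U: "U \<in> nbhds_one G T"
  obtains V where "V \<in> nbhds_one G T" "\<And>x. x \<in> V \<Longrightarrow> g \<otimes>\<^bsub>G\<^esub> x \<otimes>\<^bsub>G\<^esub> inv\<^bsub>G\<^esub> g \<in> U"
proof -
  interpret group G using G by (simp add: topological_group_def)
  have top: "topspace T = carrier G"
    and mult: "continuous_map (prod_topology T T) T (\<lambda>(x, y). x \<otimes>\<^bsub>G\<^esub> y)"
    using G by (auto simp: topological_group_def)
  have prod: "continuous_map T T (\<lambda>x. p x \<otimes>\<^bsub>G\<^esub> q x)" if "continuous_map T T p" "continuous_map T T q" for p q
    using continuous_map_compose[OF continuous_map_pairedI[OF that] mult] by (simp add: o_def)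
  obtain W where W: "openin T W" "\<one>\<^bsub>G\<^esub> \<in> W" "W \<subseteq> U" using U by (auto simp: nbhds_one_def)
  let ?V = "{x \<in> topspace T. g \<otimes>\<^bsub>G\<^esub> x \<otimes>\<^bsub>G\<^esub> inv\<^bsub>G\<^esub> g \<in> W}"
  have "openin T ?V"
    by (rule openin_continuous_map_preimage[OF _ W(1)]) (intro prod; use g top in simp)
  then have "?V \<in> nbhds_one G T"
    unfolding nbhds_one_def using W(2) g top by (auto intro!: exI[of _ ?V])
  then show ?thesis using W(3) by (intro that[of ?V]) auto
qed

text \<open>Left translation by \<open>g\<close> changes the quotient x y^-1 into its conjugate by
  \<open>g\<close>, so the neighbourhood has to be shrunk by means of
  \<open>nbhds_one_conj\<close>.\<close>

lemma RUCB_translate: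
  assumes G: "topological_group G T" and g: "g \<in> carrier G" and f: "f \<in> RUCB G T"
  shows "(\<lambda>x\<in>carrier G. f (g \<otimes>\<^bsub>G\<^esub> x)) \<in> RUCB G T"
  unfolding RUCB_iff
proof (intro conjI allI impI)
  interpret group G using G by (simp add: topological_group_def)
  show "bounded ((\<lambda>x\<in>carrier G. f (g \<otimes>\<^bsub>G\<^esub> x)) ` carrier G)"
    by (rule bounded_subset[of "f ` carrier G"]) (use f g in \<open>auto simp: RUCB_iff\<close>)
  fix e :: real assume "0 < e"
  then obtain U where U: "U \<in> nbhds_one G T"
    "\<And>x y. x \<in> carrier G \<Longrightarrow> y \<in> carrier G \<Longrightarrow> x \<otimes>\<^bsub>G\<^esub> inv\<^bsub>G\<^esub> y \<in> U \<Longrightarrow> \<bar>f x - f y\<bar> < e"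
    using f unfolding RUCB_iff by blast
  obtain V where V: "V \<in> nbhds_one G T" "\<And>x. x \<in> V \<Longrightarrow> g \<otimes>\<^bsub>G\<^esub> x \<otimes>\<^bsub>G\<^esub> inv\<^bsub>G\<^esub> g \<in> U"
    using nbhds_one_conj[OF G g U(1)] by blast
  show "\<exists>U\<in>nbhds_one G T. \<forall>x\<in>carrier G. \<forall>y\<in>carrier G. x \<otimes>\<^bsub>G\<^esub> inv\<^bsub>G\<^esub> y \<in> U \<longrightarrow>
      \<bar>(\<lambda>x\<in>carrier G. f (g \<otimes>\<^bsub>G\<^esub> x)) x - (\<lambda>x\<in>carrier G. f (g \<otimes>\<^bsub>G\<^esub> x)) y\<bar> < e"
  proof (intro bexI[OF _ V(1)] ballI impI)
    fix x y assume xy: "x \<in> carrier G" "y \<in> carrier G" "x \<otimes>\<^bsub>G\<^esub> inv\<^bsub>G\<^esub> y \<in> V"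
    have "(g \<otimes>\<^bsub>G\<^esub> x) \<otimes>\<^bsub>G\<^esub> inv\<^bsub>G\<^esub> (g \<otimes>\<^bsub>G\<^esub> y) = g \<otimes>\<^bsub>G\<^esub> (x \<otimes>\<^bsub>G\<^esub> inv\<^bsub>G\<^esub> y) \<otimes>\<^bsub>G\<^esub> inv\<^bsub>G\<^esub> g"
      using g xy(1,2) by (simp add: inv_mult_group m_assoc)
    then show "\<bar>(\<lambda>x\<in>carrier G. f (g \<otimes>\<^bsub>G\<^esub> x)) x - (\<lambda>x\<in>carrier G. f (g \<otimes>\<^bsub>G\<^esub> x)) y\<bar> < e"
      using U(2)[of "g \<otimes>\<^bsub>G\<^esub> x" "g \<otimes>\<^bsub>G\<^esub> y"] V(2)[OF xy(3)] g xy(1,2) by simp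
  qed
qed simp

lemma RUCB_restrict:
  assumes "group G" and H: "subgroup H G" and f: "f \<in> RUCB G T"
  shows "restrict f H \<in> RUCB (G\<lparr>carrier := H\<rparr>) (subtopology T H)"
  unfolding RUCB_iff
proof (intro conjI allI impI)
  interpret group G by fact
  have HG: "H \<subseteq> carrier G" using subgroup.subset[OF H] .
  show "restrict f H \<in> extensional (carrier (G\<lparr>carrier := H\<rparr>))" by simp
  show "bounded (restrict f H ` carrier (G\<lparr>carrier := H\<rparr>))"
    by (rule bounded_subset[of "f ` carrier G"]) (use f HG in \<open>auto simp: RUCB_iff\<close>)
  fix e :: real assume "0 < e"
  then obtain U where U: "U \<in> nbhds_one G T"
    "\<And>x y. x \<in> carrier G \<Longrightarrow> y \<in> carrier G \<Longrightarrow> x \<otimes>\<^bsub>G\<^esub> inv\<^bsub>G\<^esub> y \<in> U \<Longrightarrow> \<bar>f x - f y\<bar> < e"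
    using f unfolding RUCB_iff by blast
  obtain W where W: "openin T W" "\<one>\<^bsub>G\<^esub> \<in> W" "W \<subseteq> U" using U(1) by (auto simp: nbhds_one_def)
  have "openin (subtopology T H) (W \<inter> H)" using W(1) by (auto simp: openin_subtopology)
  moreover have "\<one>\<^bsub>G\<^esub> \<in> W \<inter> H" using W(2) subgroup.one_closed[OF H] by simp
  ultimately have "U \<inter> H \<in> nbhds_one (G\<lparr>carrier := H\<rparr>) (subtopology T H)"
    unfolding nbhds_one_def using W(3) by (auto intro!: exI[of _ "W \<inter> H"])
  then show "\<exists>U\<in>nbhds_one (G\<lparr>carrier := H\<rparr>) (subtopology T H).
      \<forall>x\<in>carrier (G\<lparr>carrier := H\<rparr>). \<forall>y\<in>carrier (G\<lparr>carrier := H\<rparr>).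
        x \<otimes>\<^bsub>G\<lparr>carrier := H\<rparr>\<^esub> inv\<^bsub>G\<lparr>carrier := H\<rparr>\<^esub> y \<in> U \<longrightarrow> \<bar>restrict f H x - restrict f H y\<bar> < e"
    using U(2) HG by (intro bexI[of _ "U \<inter> H"]) (auto simp: m_inv_consistent[OF H])
qed

section \<open>Averaging over a subgroup with an invariant mean\<close>

locale subgroup_mean =
  fixes G :: "('a, 'z) monoid_scheme" and T :: "'a topology" and H :: "'a set" and \<nu> :: "('a \<Rightarrow> real) \<Rightarrow> real"
  assumes top_group: "topological_group G T" and subgroup: "subgroup H G"
    and mean: "\<nu> \<in> means (right_uspace (G\<lparr>carrier := H\<rparr>) (subtopology T H))"
    and invariant: "left_invariant (G\<lparr>carrier := H\<rparr>) (subtopology T H) \<nu>"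
begin

abbreviation "XG \<equiv> right_uspace G T"
abbreviation "XH \<equiv> right_uspace (G\<lparr>carrier := H\<rparr>) (subtopology T H)"
abbreviation "XQ \<equiv> coset_uspace G T H"
abbreviation "\<pi> \<equiv> coset_proj G H"
abbreviation "E \<equiv> Phi G (embed_mean G T H \<nu>)"

lemma is_group: "group G"
  using top_group by (simp add: topological_group_def)

lemma topspace_eq: "topspace T = carrier G"
  using top_group by (simp add: topological_group_def)

sublocale group G by (rule is_group)

lemma H_carrier: "h \<in> H \<Longrightarrow> h \<in> carrier G"
  using subgroup.subset[OF subgroup] by blast

sublocale G: filtered_uspace XG
  by (intro filtered_right_uspace topspace_eq one_closed)

sublocale H: filtered_uspace XH
  using subgroup.one_closed[OF subgroup] subgroup.subset[OF subgroup]
  by (intro filtered_right_uspace) (auto simp: topspace_eq)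

sublocale Q: filtered_uspace XQ
  by (intro filtered_coset_uspace topspace_eq one_closed)

lemma points_XH: "points XH = H"
  by (simp add: points_right_uspace)

lemma slice_RUCB:
  assumes "f \<in> RUCB G T" "g \<in> carrier G"
  shows "(\<lambda>x\<in>H. f (g \<otimes>\<^bsub>G\<^esub> x)) \<in> UCB XH"
proof -
  have "restrict (\<lambda>x\<in>carrier G. f (g \<otimes>\<^bsub>G\<^esub> x)) H = (\<lambda>x\<in>H. f (g \<otimes>\<^bsub>G\<^esub> x))"
    by (auto simp: restrict_def H_carrier)
  then show ?thesis
    using RUCB_restrict[OF is_group subgroup RUCB_translate[OF top_group assms(2,1)]] by simp
qed

text \<open>\<open>embed_mean\<close> is \<open>undefined\<close> off \<open>RUCB G T\<close>; the
  translate must be known to lie there before the definition can be unfolded.\<close>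

lemma Phi_eq:
  assumes "f \<in> RUCB G T" "g \<in> carrier G"
  shows "E f g = \<nu> (\<lambda>x\<in>H. f (g \<otimes>\<^bsub>G\<^esub> x))"
proof -
  have "restrict (\<lambda>x\<in>carrier G. f (g \<otimes>\<^bsub>G\<^esub> x)) H = (\<lambda>x\<in>H. f (g \<otimes>\<^bsub>G\<^esub> x))"
    by (auto simp: restrict_def H_carrier)
  then show ?thesis
    using assms RUCB_translate[OF top_group assms(2,1)] by (simp add: Phi_def embed_mean_def)
qed

text \<open>Right translation leaves x y^-1 unchanged, so one neighbourhood controls the slices at
  all points of \<open>H\<close> simultaneously, and a mean does not increase a uniform bound.
  Starting from e / 2 compensates for the weak inequality that a mean returns.\<close>

lemma Phi_RUCB:
  assumes f: "f \<in> RUCB G T"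
  shows "E f \<in> RUCB G T"
  unfolding RUCB_iff
proof (intro conjI allI impI)
  show "E f \<in> extensional (carrier G)" by (simp add: Phi_def)
  obtain B where B: "\<And>x. x \<in> carrier G \<Longrightarrow> \<bar>f x\<bar> \<le> B"
    using G.UCB_bounded[OF f] by (auto simp: points_right_uspace)
  have "\<bar>E f g\<bar> \<le> B" if g: "g \<in> carrier G" for g
    unfolding Phi_eq[OF f g]
    by (rule H.means_abs_le[OF mean slice_RUCB[OF f g]]) (simp add: points_XH B g H_carrier)
  then show "bounded (E f ` carrier G)" by (auto simp: bounded_iff)
  fix e :: real assume e: "0 < e"
  then obtain U where U: "U \<in> nbhds_one G T"
    "\<And>x y. x \<in> carrier G \<Longrightarrow> y \<in> carrier G \<Longrightarrow> x \<otimes>\<^bsub>G\<^esub> inv\<^bsub>G\<^esub> y \<in> U \<Longrightarrow> \<bar>f x - f y\<bar> < e / 2"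
    using f half_gt_zero[OF e] unfolding RUCB_iff by blast
  show "\<exists>U\<in>nbhds_one G T. \<forall>x\<in>carrier G. \<forall>y\<in>carrier G. x \<otimes>\<^bsub>G\<^esub> inv\<^bsub>G\<^esub> y \<in> U \<longrightarrow> \<bar>E f x - E f y\<bar> < e"
  proof (intro bexI[OF _ U(1)] ballI impI)
    fix x y assume x: "x \<in> carrier G" and y: "y \<in> carrier G" and xy: "x \<otimes>\<^bsub>G\<^esub> inv\<^bsub>G\<^esub> y \<in> U"
    let ?d = "\<lambda>z\<in>H. (\<lambda>z\<in>H. f (x \<otimes>\<^bsub>G\<^esub> z)) z - (\<lambda>z\<in>H. f (y \<otimes>\<^bsub>G\<^esub> z)) z"
    have "E f x - E f y = \<nu> ?d"
      using H.means_diff[OF mean slice_RUCB[OF f x] slice_RUCB[OF f y]]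
      by (simp only: Phi_eq[OF f x] Phi_eq[OF f y] points_XH)
    moreover have "\<bar>\<nu> ?d\<bar> \<le> e / 2"
    proof (rule H.means_abs_le[OF mean])
      show "?d \<in> UCB XH"
        using H.UCB_diff[OF slice_RUCB[OF f x] slice_RUCB[OF f y]] by (simp only: points_XH)
      fix z assume "z \<in> points XH"
      then have z: "z \<in> H" "z \<in> carrier G" using H_carrier by (auto simp: points_XH)
      have "(x \<otimes>\<^bsub>G\<^esub> z) \<otimes>\<^bsub>G\<^esub> inv\<^bsub>G\<^esub> (y \<otimes>\<^bsub>G\<^esub> z) = x \<otimes>\<^bsub>G\<^esub> (z \<otimes>\<^bsub>G\<^esub> (inv\<^bsub>G\<^esub> z \<otimes>\<^bsub>G\<^esub> inv\<^bsub>G\<^esub> y))"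
        using x y z(2) by (simp add: inv_mult_group m_assoc)
      also have "\<dots> = x \<otimes>\<^bsub>G\<^esub> inv\<^bsub>G\<^esub> y"
        using y z(2) by (simp flip: m_assoc[of z])
      finally show "\<bar>?d z\<bar> \<le> e / 2"
        using U(2)[of "x \<otimes>\<^bsub>G\<^esub> z" "y \<otimes>\<^bsub>G\<^esub> z"] x y z xy by simp
    qed
    ultimately show "\<bar>E f x - E f y\<bar> < e" using e by linarith
  qed
qed

text \<open>The slice of \<open>f\<close> at g h is the slice at \<open>g\<close> translated on the
  left by \<open>h\<close>, a change that \<nu> does not see.\<close>

lemma Phi_right_invariant:
  assumes f: "f \<in> RUCB G T" and g: "g \<in> carrier G" and h: "h \<in> H"
  shows "E f (g \<otimes>\<^bsub>G\<^esub> h) = E f g"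
proof -
  let ?F = "\<lambda>x\<in>H. f (g \<otimes>\<^bsub>G\<^esub> x)"
  have "(\<lambda>x\<in>H. f (g \<otimes>\<^bsub>G\<^esub> h \<otimes>\<^bsub>G\<^esub> x)) = (\<lambda>x\<in>H. ?F (h \<otimes>\<^bsub>G\<^esub> x))"
    using g h by (auto simp: restrict_def fun_eq_iff m_assoc H_carrier subgroup.m_closed[OF subgroup])
  moreover have "\<nu> (\<lambda>x\<in>H. ?F (h \<otimes>\<^bsub>G\<^esub> x)) = \<nu> ?F"
    using invariant slice_RUCB[OF f g] h by (simp add: left_invariant_def del: restrict_apply)
  ultimately show ?thesis
    using Phi_eq[OF f, of "g \<otimes>\<^bsub>G\<^esub> h"] Phi_eq[OF f g] g h by (simp add: H_carrier)
qed

lemma coset_proj_mult: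
  assumes g: "g \<in> carrier G" and h: "h \<in> H"
  shows "\<pi> (g \<otimes>\<^bsub>G\<^esub> h) = \<pi> g"
  unfolding coset_proj_def l_coset_def
proof (intro equalityI UN_least)
  fix x assume x: "x \<in> H"
  have "g \<otimes>\<^bsub>G\<^esub> h \<otimes>\<^bsub>G\<^esub> x = g \<otimes>\<^bsub>G\<^esub> (h \<otimes>\<^bsub>G\<^esub> x)"
    using g h x by (simp add: m_assoc H_carrier)
  then show "{g \<otimes>\<^bsub>G\<^esub> h \<otimes>\<^bsub>G\<^esub> x} \<subseteq> (\<Union>h\<in>H. {g \<otimes>\<^bsub>G\<^esub> h})"
    using subgroup.m_closed[OF subgroup h x] by auto
  have "g \<otimes>\<^bsub>G\<^esub> x = g \<otimes>\<^bsub>G\<^esub> h \<otimes>\<^bsub>G\<^esub> (inv\<^bsub>G\<^esub> h \<otimes>\<^bsub>G\<^esub> x)"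
    using g h x by (simp add: m_assoc[symmetric] H_carrier) (simp add: m_assoc H_carrier)
  then show "{g \<otimes>\<^bsub>G\<^esub> x} \<subseteq> (\<Union>x\<in>H. {g \<otimes>\<^bsub>G\<^esub> h \<otimes>\<^bsub>G\<^esub> x})"
    using subgroup.m_closed[OF subgroup subgroup.m_inv_closed[OF subgroup h] x] by auto
qed

lemma coset_proj_eqD:
  assumes "x \<in> carrier G" "y \<in> carrier G" "\<pi> x = \<pi> y"
  obtains h where "h \<in> H" "y = x \<otimes>\<^bsub>G\<^esub> h"
proof -
  have "y \<otimes>\<^bsub>G\<^esub> \<one>\<^bsub>G\<^esub> \<in> \<pi> y"
    using subgroup.one_closed[OF subgroup] by (auto simp: coset_proj_def l_coset_def)
  then have "y \<in> \<pi> x" using assms by simp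
  then show ?thesis using that by (auto simp: coset_proj_def l_coset_def)
qed

lemma Phi_factors:
  assumes f: "f \<in> RUCB G T"
  obtains k where "k \<in> UCB XQ" "\<And>x. x \<in> carrier G \<Longrightarrow> k (\<pi> x) = E f x"
proof -
  define k where "k = (\<lambda>C\<in>\<pi> ` carrier G. E f (SOME x. x \<in> carrier G \<and> \<pi> x = C))"
  have k: "k (\<pi> x) = E f x" if x: "x \<in> carrier G" for x
  proof -
    let ?y = "SOME y. y \<in> carrier G \<and> \<pi> y = \<pi> x"
    have y: "?y \<in> carrier G \<and> \<pi> ?y = \<pi> x" by (rule someI[of _ x]) (use x in simp)
    then obtain h where "h \<in> H" "?y = x \<otimes>\<^bsub>G\<^esub> h" using coset_proj_eqD[OF x, of ?y] by auto
    then have "E f ?y = E f x" using Phi_right_invariant[OF f x] by simp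
    then show ?thesis using x by (simp add: k_def)
  qed
  have "k ` \<pi> ` carrier G = E f ` carrier G" using k by (force simp: image_image)
  \<comment> \<open>The uniformity of G/H is tested on representatives by the same condition on x
    y^-1 as the one of G, so the estimates for \<open>E f\<close> carry over to \<open>k\<close>
    verbatim.\<close>
  then have "k \<in> UCB XQ"
    using Phi_RUCB[OF f] unfolding UCB_coset_iff RUCB_iff by (simp add: k) (simp add: k_def)
  with k show ?thesis using that by blast
qed

lemma pullback_RUCB: "k \<in> UCB XQ \<Longrightarrow> (\<lambda>x\<in>points XG. k (\<pi> x)) \<in> UCB XG"
  unfolding UCB_coset_iff RUCB_iff by (simp add: points_right_uspace image_image)

lemma coset_proj_points: "x \<in> points XG \<Longrightarrow> \<pi> x \<in> points XQ"
  by (simp add: points_right_uspace points_coset_uspace)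

text \<open>On the coset of \<open>g\<close> the pullback of \<open>k\<close> is constant, so it
  leaves \<nu> as a scalar. This is the module property expected of a conditional
  expectation.\<close>

lemma Phi_pullback_mult:
  assumes k: "k \<in> UCB XQ" and f: "f \<in> RUCB G T"
  shows "E (\<lambda>x\<in>points XG. (\<lambda>x\<in>points XG. k (\<pi> x)) x * f x) =
    (\<lambda>x\<in>points XG. (\<lambda>x\<in>points XG. k (\<pi> x)) x * E f x)"
    (is "E ?h = ?r")
proof
  fix g
  have h: "?h \<in> RUCB G T" by (rule G.UCB_mult[OF pullback_RUCB[OF k] f])
  show "E ?h g = ?r g"
  proof (cases "g \<in> carrier G")
    case True
    let ?F = "\<lambda>x\<in>H. f (g \<otimes>\<^bsub>G\<^esub> x)"
    have "(\<lambda>x\<in>H. ?h (g \<otimes>\<^bsub>G\<^esub> x)) = (\<lambda>x\<in>points XH. k (\<pi> g) * ?F x)"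
      using True by (auto simp: points_right_uspace restrict_def fun_eq_iff H_carrier coset_proj_mult)
    moreover have "\<nu> (\<lambda>x\<in>points XH. k (\<pi> g) * ?F x) = k (\<pi> g) * \<nu> ?F"
      using mean slice_RUCB[OF f True] unfolding means_def by blast
    ultimately show ?thesis
      using Phi_eq[OF h True] Phi_eq[OF f True] True by (simp add: points_right_uspace)
  qed (simp add: Phi_def points_right_uspace)
qed

end

section \<open>Identification of the conditional expectation\<close>

theorem lemma4p3:
  fixes G :: "('a, 'z) monoid_scheme" and T :: "'a topology" and H :: "'a set"
    and \<nu> \<mu> :: "('a \<Rightarrow> real) \<Rightarrow> real" and f :: "'a \<Rightarrow> real"
  defines "mhat \<equiv> hat (right_uspace G T) \<mu>"
    and "F \<equiv> vimage_algebra (samuel (right_uspace G T))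
          (samuel_map (right_uspace G T) (coset_uspace G T H) (coset_proj G H))
          (borel_of_top (samuel_top (coset_uspace G T H)))"
  assumes "topological_group G T"
    and "subgroup H G"
    and "\<nu> \<in> means (right_uspace (G\<lparr>carrier := H\<rparr>) (subtopology T H))"
    and "left_invariant (G\<lparr>carrier := H\<rparr>) (subtopology T H) \<nu>"
    and "\<mu> \<in> means (right_uspace G T)"
    and "mean_conv G T \<mu> (embed_mean G T H \<nu>) = \<mu>"
    and "f \<in> RUCB G T"
  shows "cond_exp_version mhat F (bar f) (bar (Phi G (embed_mean G T H \<nu>) f)) \<and>
    (AE \<xi> in mhat. real_cond_exp mhat F (bar f) \<xi> = bar (Phi G (embed_mean G T H \<nu>) f) \<xi>)"
proof -
  interpret subgroup_mean G T H \<nu>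
    by (rule subgroup_mean.intro) fact+
  note f = assms(9)
  let ?S = "samuel_map XG XQ \<pi>"
  have S: "continuous_map (samuel_top XG) (samuel_top XQ) ?S"
    by (rule continuous_map_samuel_map[where \<phi> = \<pi>,
          OF G.filtered_uspace_axioms Q.filtered_uspace_axioms coset_proj_points pullback_RUCB])
  have m: "regular_borel_prob (samuel_top XG) mhat"
    and int_bar: "\<And>h. h \<in> UCB XG \<Longrightarrow> integral\<^sup>L mhat (bar h) = \<mu> h"
    using G.hat_representing[OF assms(7)] by (auto simp: mhat_def)
  note D = regular_borel_probD[OF m]
  interpret prob_space mhat by (rule D(2))
  have Ef: "E f \<in> UCB XG" by (rule Phi_RUCB[OF f])
  have integrable_bar: "integrable mhat (bar h)" if "h \<in> UCB XG" for h
    by (rule G.integrable_lattice[OF m G.bar_in_ucb_functions[OF that]])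
  have S_space: "?S \<in> samuel XG \<rightarrow> space (borel_of_top (samuel_top XQ))"
    using continuous_map_funspace[OF S]
    by (simp add: space_borel_of_top G.topspace_samuel_top)
  have space_F: "space F = samuel XG" by (simp add: F_def)
  have S_F: "?S \<in> measurable F (borel_of_top (samuel_top XQ))"
    unfolding F_def by (rule measurable_vimage_algebra1[OF S_space])
  have sets_F: "sets F = {?S -` B \<inter> samuel XG | B. B \<in> sets (borel_of_top (samuel_top XQ))}"
    unfolding F_def by (rule sets_vimage_algebra2[OF S_space])
  have "?S \<in> measurable mhat (borel_of_top (samuel_top XQ))"
    using continuous_map_measurable_borel_of_top[OF S] measurable_cong_sets[OF D(1) refl] by blast
  from measurable_sets[OF this] have subalg: "subalgebra mhat F"
    by (auto simp: subalgebra_def space_F sets_F D(3) G.topspace_samuel_top)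
  obtain k where k: "k \<in> UCB XQ" "\<And>x. x \<in> carrier G \<Longrightarrow> k (\<pi> x) = E f x"
    using Phi_factors[OF f] by blast
  have bar_E: "bar (E f) \<xi> = bar k (?S \<xi>)" if "\<xi> \<in> samuel XG" for \<xi>
  proof -
    have "(\<lambda>x\<in>points XG. k (\<pi> x)) = E f"
      using k(2) by (intro G.UCB_eqI[OF Ef]) (simp add: points_right_uspace)
    then show ?thesis by (simp add: bar_def samuel_map_apply[OF that k(1)])
  qed
  \<comment> \<open>The factorization through S(\<pi>) gives measurability for the smaller algebra
    \<open>F\<close>, which continuity of \<open>bar (E f)\<close> alone would not.\<close>
  have "(\<lambda>\<xi>. bar k (?S \<xi>)) \<in> borel_measurable F"
    by (rule measurable_compose[OF S_F continuous_map_borel_measurable[OF Q.continuous_map_bar[OF k(1)]]])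
  then have meas: "bar (E f) \<in> borel_measurable F"
    by (subst measurable_cong[where g = "\<lambda>\<xi>. bar k (?S \<xi>)"]) (simp_all only: space_F bar_E)
  have \<mu>_E: "\<mu> h = \<mu> (E h)" if "h \<in> UCB XG" for h
    using fun_cong[OF assms(8), of h] that by (simp add: mean_conv_def)
  have zero: "(\<integral>\<xi>. \<Phi> (?S \<xi>) * (bar f \<xi> - bar (E f) \<xi>) \<partial>mhat) = 0" if \<Phi>: "\<Phi> \<in> Q.ucb_functions" for \<Phi>
  proof -
    let ?l = "Q.on_points \<Phi>"
    let ?p = "\<lambda>x\<in>points XG. ?l (\<pi> x)"
    have l: "?l \<in> UCB XQ" by (rule Q.ucb_functionsE(1)[OF \<Phi>])
    have p: "?p \<in> UCB XG" by (rule pullback_RUCB[OF l])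
    let ?pf = "\<lambda>x\<in>points XG. ?p x * f x" and ?pE = "\<lambda>x\<in>points XG. ?p x * E f x"
    have pf: "?pf \<in> UCB XG" "?pE \<in> UCB XG" by (intro G.UCB_mult p f Ef)+
    have "\<Phi> (?S \<xi>) * (bar f \<xi> - bar (E f) \<xi>) = bar ?pf \<xi> - bar ?pE \<xi>" if \<xi>: "\<xi> \<in> samuel XG" for \<xi>
    proof -
      have "?S \<xi> \<in> samuel XQ"
        using S_space \<xi> by (auto simp: space_borel_of_top Q.topspace_samuel_top)
      then have "\<Phi> (?S \<xi>) = \<xi> ?p"
        by (simp only: Q.ucb_functionsE(2)[OF \<Phi>] samuel_map_apply[OF \<xi> l])
      then show ?thesis
        unfolding bar_def G.samuelD(3)[OF \<xi> p f] G.samuelD(3)[OF \<xi> p Ef]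
        by (simp only: right_diff_distrib)
    qed
    then have "(\<integral>\<xi>. \<Phi> (?S \<xi>) * (bar f \<xi> - bar (E f) \<xi>) \<partial>mhat) = (\<integral>\<xi>. bar ?pf \<xi> - bar ?pE \<xi> \<partial>mhat)"
      by (intro Bochner_Integration.integral_cong refl) (simp only: D(3) G.topspace_samuel_top)
    also have "\<dots> = \<mu> ?pf - \<mu> ?pE"
      using integrable_bar[OF pf(1)] integrable_bar[OF pf(2)]
      by (simp only: Bochner_Integration.integral_diff int_bar[OF pf(1)] int_bar[OF pf(2)])
    \<comment> \<open>Invariance of \<mu> replaces \<open>?pf\<close> by its average, which the
      module property identifies with \<open>?pE\<close>.\<close>
    also have "\<mu> ?pf = \<mu> ?pE"
      by (simp only: \<mu>_E[OF pf(1)] Phi_pullback_mult[OF l f])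
    finally show ?thesis by (simp only: diff_self)
  qed
  have "(\<lambda>\<xi>. bar f \<xi> - bar (E f) \<xi>) \<in> G.ucb_functions"
    by (intro G.diff_closed G.bar_in_ucb_functions f Ef)
  then obtain c where c: "\<And>\<xi>. \<xi> \<in> topspace (samuel_top XG) \<Longrightarrow> \<bar>bar f \<xi> - bar (E f) \<xi>\<bar> \<le> c"
    using G.bounded_closed by blast
  have ind: "(\<integral>\<xi>. indicator B \<xi> * bar f \<xi> \<partial>mhat) = (\<integral>\<xi>. indicator B \<xi> * bar (E f) \<xi> \<partial>mhat)"
    if B: "B \<in> sets F" for B
  proof -
    obtain C where C: "C \<in> sets (borel_of_top (samuel_top XQ))" "B = ?S -` C \<inter> samuel XG"
      using B sets_F by auto
    have Bm: "B \<in> sets mhat" using B subalg by (auto simp: subalgebra_def)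
    have int: "integrable mhat (\<lambda>\<xi>. indicator B \<xi> * bar h \<xi>)" if "h \<in> UCB XG" for h
      using integrable_real_mult_indicator[OF Bm integrable_bar[OF that]] by (simp add: mult.commute)
    have "(\<integral>\<xi>. indicator B \<xi> * (bar f \<xi> - bar (E f) \<xi>) \<partial>mhat) = 0"
      unfolding C(2) G.topspace_samuel_top[symmetric]
      by (rule integral_indicator_vimage_eq_0[OF m Q.separating_lattice_axioms S _ c zero C(1)])
        (intro Bochner_Integration.integrable_diff integrable_bar f Ef)
    then show ?thesis
      using int[OF f] int[OF Ef] by (simp add: right_diff_distrib)
  qed
  interpret finite_measure_subalgebra mhat F
    by unfold_locales (rule subalg)
  \<comment> \<open>Conditional expectations are determined up to null sets, so the version property
    gives agreement with \<open>real_cond_exp\<close> almost everywhere.\<close>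
  have "AE \<xi> in mhat. real_cond_exp mhat F (bar f) \<xi> = bar (E f) \<xi>"
    by (rule real_cond_exp_charact)
      (simp_all add: set_lebesgue_integral_def ind integrable_bar f Ef meas)
  then show ?thesis
    using prob_space_axioms subalg integrable_bar[OF f] integrable_bar[OF Ef] meas ind
    by (simp add: cond_exp_version_def)
qed

end
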